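(* Let $G$ be a finite group, let $G^\ast$ be a cover of $G$, and let $M$ be the kernel of the map from $G^\ast$ onto $G$. For every $n\geq 2$ there exists an isomorphism $$\mathcal K(G^\ast,n)/\mathcal K(M,n)\;\cong\;\widetilde{\mathcal K}(G,n).$$ In particular, the group on the left depends (up to isomorphism) on $G$ and $n$ only.
   Context: For a group $G$ and $n\geq 2$, let $G^{\rm ab}=G/[G,G]$ and let $\mathcal K(G,n)$ be the kernel of the homomorphism $G^n\to G^{\rm ab}$, $(g_1,\dots,g_n)\mapsto\overline{g_1\cdots g_n}$. Choose a presentation $G\cong F/N$ with $F$ a free group and $N$ a normal subgroup of $F$. Let $\langle\langle\mathcal K(N,n)\rangle\rangle$ be the normal closure of $\mathcal K(N,n)$ in $F^n$ (it is contained in $\mathcal K(F,n)$), and define $\widetilde{\mathcal K}(G,n):=\mathcal K(F,n)/\langle\langle\mathcal K(N,n)\rangle\rangle$. Up to isomorphism this does not depend on the choice of presentation. A cover of a finite group $G$ is a group $G^\ast$ together with a central short exact sequence $0\to M\to G^\ast\to G\to 1$ such that $M\leq[G^\ast,G^\ast]$ and $M$ is isomorphic to the Schur multiplier $H^2(G,\mathbb C^\ast)$ of $G$ (trivial action), which for finite $G$ is (non-canonically) isomorphic to $H_2(G,\mathbb Z)$. Since $M$ is Abelian, $\mathcal K(M,n)=\{(m_1,\dots,m_n)\in M^n : m_1\cdots m_n=1\}$, regarded as a subgroup of $\mathcal K(G^\ast,n)$; it is central, hence normal. *)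

theory Defs
  imports Complex_Main "HOL-Algebra.Product_Groups"
begin

section \<open>The groups \<open>K(G,n)\<close>\<close>

abbreviation subgroup_of :: "('a, 'm) monoid_scheme \<Rightarrow> 'a set \<Rightarrow> ('a, 'm) monoid_scheme"
  where "subgroup_of G H \<equiv> G\<lparr>carrier := H\<rparr>"

text \<open>Tuples are indexed by \<open>{..<n}\<close> and are extensional functions, so the power of a
  subgroup \<open>N\<close> of \<open>F\<close> is literally a subset of the power of \<open>F\<close>.\<close>

definition power_group :: "('a, 'm) monoid_scheme \<Rightarrow> nat \<Rightarrow> (nat \<Rightarrow> 'a) monoid"
  where "power_group G n = product_group {..<n} (\<lambda>_. G)"

definition ordered_prod :: "('a, 'm) monoid_scheme \<Rightarrow> nat \<Rightarrow> (nat \<Rightarrow> 'a) \<Rightarrow> 'a"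
  where "ordered_prod G n g = foldr (\<lambda>i x. g i \<otimes>\<^bsub>G\<^esub> x) [0..<n] \<one>\<^bsub>G\<^esub>"

definition abelianization :: "('a, 'm) monoid_scheme \<Rightarrow> 'a set monoid"
  where "abelianization G = G Mod derived G (carrier G)"

definition K :: "('a, 'm) monoid_scheme \<Rightarrow> nat \<Rightarrow> (nat \<Rightarrow> 'a) set"
  where "K G n = kernel (power_group G n) (abelianization G)
           (\<lambda>g. derived G (carrier G) #>\<^bsub>G\<^esub> ordered_prod G n g)"

definition K_quotient :: "('a, 'm) monoid_scheme \<Rightarrow> 'a set \<Rightarrow> nat \<Rightarrow> (nat \<Rightarrow> 'a) set monoid"
  where "K_quotient E M n = subgroup_of (power_group E n) (K E n) Mod K (subgroup_of E M) n"

definition normal_closure :: "('a, 'm) monoid_scheme \<Rightarrow> 'a set \<Rightarrow> 'a set"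
  where "normal_closure G S = \<Inter>{H. H \<lhd> G \<and> S \<subseteq> H}"

definition K_tilde :: "('a, 'm) monoid_scheme \<Rightarrow> 'a set \<Rightarrow> nat \<Rightarrow> (nat \<Rightarrow> 'a) set monoid"
  where "K_tilde F N n = subgroup_of (power_group F n) (K F n)
           Mod normal_closure (power_group F n) (K (subgroup_of F N) n)"


section \<open>Free groups and presentations\<close>

text \<open>A letter \<open>(x, True)\<close> stands for \<open>x\<close> and \<open>(x, False)\<close> for its inverse. The elements
  of the free group on \<open>S\<close> are the reduced words over \<open>S\<close>; multiplication is concatenation
  followed by cancellation, done by pushing the letters of the left factor one by one,
  the last one first, onto the right factor.\<close>

definition inverse_letters :: "'x \<times> bool \<Rightarrow> 'x \<times> bool \<Rightarrow> bool"
  where "inverse_letters a b \<longleftrightarrow> fst a = fst b \<and> snd a \<noteq> snd b"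

fun push_letter :: "'x \<times> bool \<Rightarrow> ('x \<times> bool) list \<Rightarrow> ('x \<times> bool) list" where
  "push_letter a [] = [a]"
| "push_letter a (b # w) = (if inverse_letters a b then w else a # b # w)"

definition reduced :: "('x \<times> bool) list \<Rightarrow> bool"
  where "reduced w \<longleftrightarrow> successively (\<lambda>a b. \<not> inverse_letters a b) w"

definition free_group_on :: "'x set \<Rightarrow> ('x \<times> bool) list monoid"
  where "free_group_on S =
    \<lparr>carrier = {w. reduced w \<and> set w \<subseteq> S \<times> UNIV}, monoid.mult = foldr push_letter, one = []\<rparr>"

text \<open>Taking the basis inside \<open>carrier F\<close> is no restriction: a basis on another type can be
  transported along the isomorphism.\<close>

definition is_free_group :: "('a, 'm) monoid_scheme \<Rightarrow> bool"
  where "is_free_group F \<longleftrightarrow> group F \<and> (\<exists>S \<subseteq> carrier F. free_group_on S \<cong> F)"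

definition is_presentation ::
    "('f, 'p) monoid_scheme \<Rightarrow> 'f set \<Rightarrow> ('a, 'm) monoid_scheme \<Rightarrow> bool"
  where "is_presentation F N G \<longleftrightarrow> is_free_group F \<and> N \<lhd> F \<and> F Mod N \<cong> G"


section \<open>Schur multiplier and covers\<close>

definition complex_units :: "complex monoid"
  where "complex_units = \<lparr>carrier = UNIV - {0}, monoid.mult = (*), one = 1\<rparr>"

text \<open>\<open>H\<^sup>2(G, \<complex>\<^sup>*)\<close> for the trivial action, by inhomogeneous cochains.\<close>

definition cochains2 :: "('a, 'm) monoid_scheme \<Rightarrow> ('a \<times> 'a \<Rightarrow> complex) monoid"
  where "cochains2 G = product_group (carrier G \<times> carrier G) (\<lambda>_. complex_units)"

definition cocycles2 :: "('a, 'm) monoid_scheme \<Rightarrow> ('a \<times> 'a \<Rightarrow> complex) set"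
  where "cocycles2 G = {f \<in> carrier (cochains2 G).
    \<forall>x \<in> carrier G. \<forall>y \<in> carrier G. \<forall>z \<in> carrier G.
      f (y, z) * f (x, y \<otimes>\<^bsub>G\<^esub> z) = f (x \<otimes>\<^bsub>G\<^esub> y, z) * f (x, y)}"

definition coboundaries2 :: "('a, 'm) monoid_scheme \<Rightarrow> ('a \<times> 'a \<Rightarrow> complex) set"
  where "coboundaries2 G =
    {\<lambda>(x, y) \<in> carrier G \<times> carrier G. c y * c x / c (x \<otimes>\<^bsub>G\<^esub> y) | c.
       \<forall>x \<in> carrier G. c x \<noteq> 0}"

definition schur_multiplier :: "('a, 'm) monoid_scheme \<Rightarrow> ('a \<times> 'a \<Rightarrow> complex) set monoid"
  where "schur_multiplier G = subgroup_of (cochains2 G) (cocycles2 G) Mod coboundaries2 G"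

definition center :: "('a, 'm) monoid_scheme \<Rightarrow> 'a set"
  where "center G = {z \<in> carrier G. \<forall>x \<in> carrier G. z \<otimes>\<^bsub>G\<^esub> x = x \<otimes>\<^bsub>G\<^esub> z}"

definition is_cover ::
    "('a, 'm) monoid_scheme \<Rightarrow> ('b, 'q) monoid_scheme \<Rightarrow> ('b \<Rightarrow> 'a) \<Rightarrow> bool"
  where "is_cover G E p \<longleftrightarrow> group E \<and> p \<in> epi E G \<and>
    kernel E G p \<subseteq> center E \<and> kernel E G p \<subseteq> derived E (carrier E) \<and>
    subgroup_of E (kernel E G p) \<cong> schur_multiplier G"

end

theory Submission
  imports Defs "HOL-Algebra.Multiplicative_Group"
begin

text \<open>Let \<open>F\<close> be a group with a homomorphism \<open>\<Phi> : F \<rightarrow> E\<close> such that \<open>p \<circ> \<Phi>\<close> is onto \<open>G\<close>, and let \<open>N\<close> be the kernel of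
\<open>p \<circ> \<Phi>\<close>. Then \<open>\<Phi>\<close>, applied to the entries of tuples, maps \<open>K(F,n)\<close> onto \<open>K(E,n)/K(M,n)\<close>. A tuple is in the kernel
iff all its entries lie in \<open>N\<close> and its product \<open>c\<close> satisfies \<open>\<Phi>(c) = 1\<close> and \<open>c \<in> [F,F]\<close>. On the other hand, the
normal closure of \<open>K(N,n)\<close> in \<open>F\<^sup>n\<close> contains the tuples in \<open>N\<^sup>n\<close> with product in \<open>[F,N]\<close>
(\<open>tuple_in_normal_subgroup_above_K\<close>). So everything depends on the following fact
(\<open>kernel_in_derived_subset_mixed_commutator\<close>): an element of \<open>[F,F]\<close> that \<open>\<Phi>\<close> kills lies in \<open>[F,N]\<close>.\<close>

text \<open>This is proved by duality, with characters in \<open>\<complex>\<^sup>*\<close>. An \<open>F\<close>-invariant character \<open>\<chi>\<close> of \<open>N\<close> determines, via a section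
of \<open>F \<rightarrow> G\<close>, a class in \<open>H\<^sup>2(G, \<complex>\<^sup>*)\<close>, its transgression, and the class determines the restriction of \<open>\<chi>\<close> to
\<open>N \<inter> [F,F]\<close>. The same construction for \<open>E\<close> embeds the character group of \<open>M\<close> into \<open>H\<^sup>2(G, \<complex>\<^sup>*)\<close>, because
\<open>M \<le> [E,E]\<close>. Both are finite and, as \<open>M \<cong> H\<^sup>2(G, \<complex>\<^sup>*)\<close>, they have equally many elements, so each class is the
transgression of a character \<open>\<mu>\<close> of \<open>M\<close> (\<open>cohomology_class_transgression_bij\<close>). Therefore \<open>\<chi>\<close> coincides with
\<open>\<mu> \<circ> \<Phi>\<close> on \<open>N \<inter> [F,F]\<close> for some \<open>\<mu>\<close>, and it is trivial at elements that \<open>\<Phi>\<close> kills. Since the characters of the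
abelian group \<open>N/[F,N]\<close> separate its points (\<open>character_separating\<close>), such an element lies in \<open>[F,N]\<close>.\<close>

text \<open>For a presentation of \<open>G\<close>, freeness of \<open>F\<close> provides \<open>\<Phi>\<close>. Two covers \<open>E\<close> and \<open>E'\<close> are compared by letting \<open>F\<close> be
their fibre product over \<open>G\<close>, with the two projections in the role of \<open>\<Phi>\<close>.\<close>

section \<open>Characters of abelian groups\<close>

lemma carrier_complex_units [simp]: "carrier complex_units = UNIV - {0}"
  and mult_complex_units [simp]: "mult complex_units = (*)"
  and one_complex_units [simp]: "one complex_units = 1"
  by (simp_all add: complex_units_def)

lemma comm_group_complex_units: "comm_group complex_units"
proof (rule comm_groupI)
  fix x assume "x \<in> carrier complex_units"
  then show "\<exists>y\<in>carrier complex_units. y \<otimes>\<^bsub>complex_units\<^esub> x = \<one>\<^bsub>complex_units\<^esub>"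
    by (intro bexI[of _ "inverse x"]) auto
qed auto

lemma complex_nth_root_exists:
  fixes w :: complex
  assumes "k > 0"
  obtains z where "z ^ k = w"
proof -
  have "rcis (root k (cmod w)) (Arg w / k) ^ k = w"
    using assms by (simp add: DeMoivre2 rcis_cmod_Arg)
  then show thesis by (rule that)
qed

text \<open>A partial character is given by its graph, a subgroup of \<open>R \<times> \<complex>\<^sup>*\<close> that meets \<open>1 \<times> \<complex>\<^sup>*\<close>
trivially. Graphs make restriction an inclusion, so Zorn's lemma needs only unions of chains.\<close>

definition partial_character :: "('a, 'm) monoid_scheme \<Rightarrow> ('a \<times> complex) set \<Rightarrow> bool"
  where "partial_character R S \<longleftrightarrow>
    S \<subseteq> carrier R \<times> (UNIV - {0}) \<and> (\<one>\<^bsub>R\<^esub>, 1) \<in> S \<and>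
    (\<forall>x z y w. (x, z) \<in> S \<longrightarrow> (y, w) \<in> S \<longrightarrow> (x \<otimes>\<^bsub>R\<^esub> y, z * w) \<in> S) \<and>
    (\<forall>x z. (x, z) \<in> S \<longrightarrow> (inv\<^bsub>R\<^esub> x, inverse z) \<in> S) \<and>
    (\<forall>z. (\<one>\<^bsub>R\<^esub>, z) \<in> S \<longrightarrow> z = 1)"

lemma partial_characterD:
  assumes "partial_character R S"
  shows "S \<subseteq> carrier R \<times> (UNIV - {0})"
    and "(\<one>\<^bsub>R\<^esub>, 1) \<in> S"
    and "(x, z) \<in> S \<Longrightarrow> (y, w) \<in> S \<Longrightarrow> (x \<otimes>\<^bsub>R\<^esub> y, z * w) \<in> S"
    and "(x, z) \<in> S \<Longrightarrow> (inv\<^bsub>R\<^esub> x, inverse z) \<in> S"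
    and "(\<one>\<^bsub>R\<^esub>, z) \<in> S \<Longrightarrow> z = 1"
  using assms unfolding partial_character_def by simp_all

lemma partial_character_functional:
  assumes "group R" "partial_character R S" "(x, z) \<in> S" "(x, w) \<in> S"
  shows "z = w"
proof -
  interpret group R by fact
  have x: "x \<in> carrier R" "w \<noteq> 0"
    using assms unfolding partial_character_def by auto
  have "(x \<otimes>\<^bsub>R\<^esub> inv\<^bsub>R\<^esub> x, z * inverse w) \<in> S"
    using partial_characterD(3,4)[OF assms(2)] assms(3,4) by simp
  then have "z * inverse w = 1"
    using partial_characterD(5)[OF assms(2)] x by simp
  then show ?thesis using x by (simp add: field_simps)
qed

lemma partial_character_int_pow:
  assumes "group R" "partial_character R S" "(x, z) \<in> S"
  shows "(x [^]\<^bsub>R\<^esub> (i::int), z powi i) \<in> S"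
proof -
  interpret group R by fact
  have n: "(x [^]\<^bsub>R\<^esub> (k::nat), z ^ k) \<in> S" for k
  proof (induction k)
    case 0
    then show ?case using assms(2) unfolding partial_character_def by simp
  next
    case (Suc k)
    then have "(x [^]\<^bsub>R\<^esub> k \<otimes>\<^bsub>R\<^esub> x, z ^ k * z) \<in> S"
      using assms(2,3) unfolding partial_character_def by blast
    then show ?case by (simp add: mult.commute)
  qed
  have x: "x \<in> carrier R"
    using assms unfolding partial_character_def by auto
  show ?thesis
  proof (cases i rule: int_cases)
    case (nonneg k)
    then show ?thesis using n[of k] by (simp add: int_pow_int)
  next
    case (neg k)
    have "(inv\<^bsub>R\<^esub> (x [^]\<^bsub>R\<^esub> Suc k), inverse (z ^ Suc k)) \<in> S"
      using n[of "Suc k"] assms unfolding partial_character_def by blast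
    then show ?thesis
      using x neg by (simp only: int_pow_neg_int power_int_minus power_int_of_nat)
  qed
qed

text \<open>The graph generated by \<open>S\<close> and \<open>(a, z)\<close> is single-valued exactly when the prescribed value \<open>z\<close> agrees
with \<open>S\<close> on those powers of \<open>a\<close> on which \<open>S\<close> is already defined.\<close>

lemma partial_character_extend:
  assumes "comm_group R" "partial_character R S" "a \<in> carrier R" "z \<noteq> 0"
    and compat: "\<And>i w. (a [^]\<^bsub>R\<^esub> (i::int), w) \<in> S \<Longrightarrow> w = z powi i"
  shows "\<exists>T. partial_character R T \<and> S \<subseteq> T \<and> (a, z) \<in> T"
proof -
  interpret comm_group R by fact
  define T where "T = {(s \<otimes>\<^bsub>R\<^esub> a [^]\<^bsub>R\<^esub> (i::int), t * z powi i) | s t i. (s, t) \<in> S}"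
  have S: "s \<in> carrier R" "t \<noteq> 0" if "(s, t) \<in> S" for s t
    using that assms(2) unfolding partial_character_def by auto
  have one: "(\<one>\<^bsub>R\<^esub>, 1) \<in> S"
    and S_mult: "\<And>x z y w. (x, z) \<in> S \<Longrightarrow> (y, w) \<in> S \<Longrightarrow> (x \<otimes>\<^bsub>R\<^esub> y, z * w) \<in> S"
    and S_inv: "\<And>x z. (x, z) \<in> S \<Longrightarrow> (inv\<^bsub>R\<^esub> x, inverse z) \<in> S"
    using partial_characterD(2-4)[OF assms(2)] by simp_all
  have "partial_character R T"
    unfolding partial_character_def
  proof (intro conjI allI impI)
    show "T \<subseteq> carrier R \<times> (UNIV - {0})"
      using S assms(3,4) unfolding T_def by auto
    show "(\<one>\<^bsub>R\<^esub>, 1) \<in> T"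
    proof -
      have "\<one>\<^bsub>R\<^esub> = \<one>\<^bsub>R\<^esub> \<otimes>\<^bsub>R\<^esub> a [^]\<^bsub>R\<^esub> (0::int)" "1 = 1 * z powi 0" by auto
      then show ?thesis unfolding T_def using one by blast
    qed
  next
    fix x u y v assume "(x, u) \<in> T" "(y, v) \<in> T"
    then obtain s t i s' t' j where
      st: "(s, t) \<in> S" "x = s \<otimes>\<^bsub>R\<^esub> a [^]\<^bsub>R\<^esub> (i::int)" "u = t * z powi i"
        "(s', t') \<in> S" "y = s' \<otimes>\<^bsub>R\<^esub> a [^]\<^bsub>R\<^esub> (j::int)" "v = t' * z powi j"
      unfolding T_def by blast
    have "x \<otimes>\<^bsub>R\<^esub> y = (s \<otimes>\<^bsub>R\<^esub> s') \<otimes>\<^bsub>R\<^esub> a [^]\<^bsub>R\<^esub> (i + j)"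
      using st S assms(3) by (simp add: int_pow_mult m_ac)
    moreover have "u * v = (t * t') * z powi (i + j)"
      using st assms(4) by (simp add: power_int_add)
    ultimately show "(x \<otimes>\<^bsub>R\<^esub> y, u * v) \<in> T"
      unfolding T_def using S_mult[OF st(1,4)] by blast
  next
    fix x u assume "(x, u) \<in> T"
    then obtain s t i where
      st: "(s, t) \<in> S" "x = s \<otimes>\<^bsub>R\<^esub> a [^]\<^bsub>R\<^esub> (i::int)" "u = t * z powi i"
      unfolding T_def by blast
    have "inv\<^bsub>R\<^esub> x = inv\<^bsub>R\<^esub> s \<otimes>\<^bsub>R\<^esub> a [^]\<^bsub>R\<^esub> (- i)"
      using st S assms(3) by (simp add: inv_mult int_pow_neg)
    moreover have "inverse u = inverse t * z powi (- i)"
      using st by (simp add: power_int_minus)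
    ultimately show "(inv\<^bsub>R\<^esub> x, inverse u) \<in> T"
      unfolding T_def using S_inv[OF st(1)] by blast
  next
    fix u assume "(\<one>\<^bsub>R\<^esub>, u) \<in> T"
    then obtain s t i where
      st: "(s, t) \<in> S" "\<one>\<^bsub>R\<^esub> = s \<otimes>\<^bsub>R\<^esub> a [^]\<^bsub>R\<^esub> (i::int)" "u = t * z powi i"
      unfolding T_def by blast
    have "s = a [^]\<^bsub>R\<^esub> (- i)"
      using st S assms(3) by (metis int_pow_closed int_pow_neg inv_equality inv_inv)
    then have "t = z powi (- i)"
      using compat st(1) by blast
    then show "u = 1"
      using st assms(4) by (simp add: power_int_minus)
  qed
  moreover have "S \<subseteq> T"
  proof clarify
    fix s t assume st: "(s, t) \<in> S"
    then have "s = s \<otimes>\<^bsub>R\<^esub> a [^]\<^bsub>R\<^esub> (0::int)" "t = t * z powi 0"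
      using S by auto
    then show "(s, t) \<in> T" unfolding T_def using st by blast
  qed
  moreover have "(a, z) \<in> T"
  proof -
    have "a = \<one>\<^bsub>R\<^esub> \<otimes>\<^bsub>R\<^esub> a [^]\<^bsub>R\<^esub> (1::int)" "z = 1 * z powi 1"
      using assms(3) by (auto simp: int_pow_1)
    then show ?thesis unfolding T_def using one by blast
  qed
  ultimately show ?thesis by blast
qed

text \<open>This is where divisibility of \<open>\<complex>\<^sup>*\<close> enters. The exponents \<open>i\<close> with \<open>a\<^sup>i\<close> in the domain form a subgroup
\<open>k\<int>\<close> of \<open>\<int>\<close>; for \<open>k > 0\<close> any \<open>k\<close>-th root of the value at \<open>a\<^sup>k\<close> is compatible, and for \<open>k = 0\<close> any
nonzero number is.\<close>

lemma compatible_value_exists: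
  assumes "comm_group R" "partial_character R S" "a \<in> carrier R"
  shows "\<exists>z. z \<noteq> 0 \<and> (\<forall>i w. (a [^]\<^bsub>R\<^esub> (i::int), w) \<in> S \<longrightarrow> w = z powi i)"
proof -
  interpret comm_group R by fact
  have nz: "w \<noteq> 0" if "(x, w) \<in> S" for x w
    using that assms(2) unfolding partial_character_def by auto
  have S_mult: "\<And>x z y w. (x, z) \<in> S \<Longrightarrow> (y, w) \<in> S \<Longrightarrow> (x \<otimes>\<^bsub>R\<^esub> y, z * w) \<in> S"
    and S_inv: "\<And>x z. (x, z) \<in> S \<Longrightarrow> (inv\<^bsub>R\<^esub> x, inverse z) \<in> S"
    using partial_characterD(3,4)[OF assms(2)] by simp_all
  note functional = partial_character_functional[OF is_group assms(2)]
  note int_pow = partial_character_int_pow[OF is_group assms(2)]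
  define P where "P k \<longleftrightarrow> k > 0 \<and> (\<exists>w. (a [^]\<^bsub>R\<^esub> int k, w) \<in> S)" for k
  show ?thesis
  proof (cases "\<exists>k. P k")
    case False
    have "w = 1 powi i" if "(a [^]\<^bsub>R\<^esub> (i::int), w) \<in> S" for i w
    proof -
      have "i = 0"
      proof (rule ccontr)
        assume "i \<noteq> 0"
        moreover have "(a [^]\<^bsub>R\<^esub> (- i), inverse w) \<in> S"
          using S_inv[OF that] assms(3) by (simp add: int_pow_neg)
        ultimately have "P (nat \<bar>i\<bar>)"
          using that unfolding P_def by (cases "i > 0") auto
        then show False using False by blast
      qed
      then show ?thesis using that assms(2) unfolding partial_character_def by simp
    qed
    then show ?thesis by (intro exI[of _ 1]) simp
  next
    case True
    define k where "k = (LEAST k. P k)"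
    have "P k" unfolding k_def using True by (rule LeastI_ex)
    then obtain w where k: "k > 0" and w: "(a [^]\<^bsub>R\<^esub> int k, w) \<in> S"
      unfolding P_def by blast
    obtain z where z: "z ^ k = w"
      using complex_nth_root_exists[OF k] by blast
    have "z \<noteq> 0" using z nz[OF w] k by auto
    moreover have "v = z powi i" if v: "(a [^]\<^bsub>R\<^esub> (i::int), v) \<in> S" for i v
    proof -
      have kq: "(a [^]\<^bsub>R\<^esub> (int k * q), w powi q) \<in> S" for q
        using int_pow[OF w, of q] assms(3) by (simp add: int_pow_pow)
      have "(a [^]\<^bsub>R\<^esub> i \<otimes>\<^bsub>R\<^esub> a [^]\<^bsub>R\<^esub> (int k * (- (i div int k))), v * w powi (- (i div int k))) \<in> S"
        using S_mult[OF v kq] .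
      also have "a [^]\<^bsub>R\<^esub> i \<otimes>\<^bsub>R\<^esub> a [^]\<^bsub>R\<^esub> (int k * (- (i div int k))) = a [^]\<^bsub>R\<^esub> (i mod int k)"
        using assms(3) by (simp flip: int_pow_mult minus_mult_div_eq_mod)
      finally have r: "(a [^]\<^bsub>R\<^esub> (i mod int k), v * w powi (- (i div int k))) \<in> S" .
      have "i mod int k = 0"
      proof (rule ccontr)
        assume ne: "i mod int k \<noteq> 0"
        have ge: "i mod int k \<ge> 0" and lt: "i mod int k < int k" using k by auto
        then have "P (nat (i mod int k))"
          using r ne unfolding P_def by auto
        then have "k \<le> nat (i mod int k)" unfolding k_def by (rule Least_le)
        then show False using lt ge by linarith
      qed
      then have i: "i = int k * (i div int k)"
        by (metis add.right_neutral mult_div_mod_eq)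
      then have "v = w powi (i div int k)"
        using functional[OF v] kq[of "i div int k"] by metis
      also have "\<dots> = z powi (int k * (i div int k))"
        by (simp add: z power_int_mult)
      finally show ?thesis using i by simp
    qed
    ultimately show ?thesis by blast
  qed
qed

text \<open>On the cyclic subgroup generated by \<open>a\<close> there is a character that is nontrivial at \<open>a\<close>: send \<open>a\<close> to a
root of unity other than \<open>1\<close> whose order divides that of \<open>a\<close>, or to \<open>2\<close> if \<open>a\<close> has infinite order.
A maximal partial character that extends it is defined everywhere.\<close>

lemma character_separating:
  assumes "comm_group R" "a \<in> carrier R" "a \<noteq> \<one>\<^bsub>R\<^esub>"
  obtains \<chi> where "\<chi> \<in> hom R complex_units" "\<chi> a \<noteq> 1"
proof -
  interpret comm_group R by fact
  have trivial: "partial_character R {(\<one>\<^bsub>R\<^esub>, 1)}"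
    unfolding partial_character_def by auto
  \<comment> \<open>The element \<open>a\<close> has infinite order exactly when \<open>ord a = 0\<close>; then only \<open>i = 0\<close> is divisible by it.\<close>
  have "\<exists>z::complex. z \<noteq> 0 \<and> z \<noteq> 1 \<and> (\<forall>i. int (ord a) dvd i \<longrightarrow> z powi i = 1)"
  proof (cases "ord a = 0")
    case True
    then show ?thesis by (intro exI[of _ 2]) auto
  next
    case False
    then have "ord a \<ge> 2"
      using assms(2,3) ord_eq_1[of a] by linarith
    then have card: "card {z::complex. z ^ ord a = 1} \<ge> 2"
      using card_roots_unity_eq[of "ord a"] by simp
    have "\<not> {z::complex. z ^ ord a = 1} \<subseteq> {1}"
    proof
      assume "{z::complex. z ^ ord a = 1} \<subseteq> {1}"
      then have "card {z::complex. z ^ ord a = 1} \<le> card {1::complex}"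
        by (rule card_mono[rotated]) simp
      then show False using card by simp
    qed
    then obtain z :: complex where z: "z ^ ord a = 1" "z \<noteq> 1" by blast
    have "z \<noteq> 0" using z False by (metis power_0_left zero_neq_one)
    moreover have "z powi i = 1" if "int (ord a) dvd i" for i
    proof -
      obtain j where "i = int (ord a) * j" using \<open>int (ord a) dvd i\<close> by (rule dvdE)
      then show ?thesis using z(1) by (simp add: power_int_mult)
    qed
    ultimately show ?thesis using z(2) by blast
  qed
  then obtain \<zeta> :: complex where \<zeta>: "\<zeta> \<noteq> 0" "\<zeta> \<noteq> 1"
    "\<And>i. int (ord a) dvd i \<Longrightarrow> \<zeta> powi i = 1" by blast
  have "w = \<zeta> powi i" if "(a [^]\<^bsub>R\<^esub> (i::int), w) \<in> {(\<one>\<^bsub>R\<^esub>, 1)}" for i w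
  proof -
    have "a [^]\<^bsub>R\<^esub> i = \<one>\<^bsub>R\<^esub>" "w = 1" using that by auto
    then show ?thesis using \<zeta>(3)[of i] int_pow_eq_id[OF assms(2), of i] by metis
  qed
  from partial_character_extend[OF assms(1) trivial assms(2) \<zeta>(1) this]
  obtain S0 where S0: "partial_character R S0" "(a, \<zeta>) \<in> S0" by blast
  define \<A> where "\<A> = {S. partial_character R S \<and> S0 \<subseteq> S}"
  have "\<exists>M\<in>\<A>. \<forall>X\<in>\<A>. M \<subseteq> X \<longrightarrow> X = M"
  proof (rule subset_Zorn_nonempty)
    have "S0 \<in> \<A>" using S0(1) by (simp add: \<A>_def)
    then show "\<A> \<noteq> {}" by auto
  next
    fix \<C> assume "\<C> \<noteq> {}" and ch: "subset.chain \<A> \<C>"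
    from \<open>\<C> \<noteq> {}\<close> obtain S1 where S1: "S1 \<in> \<C>" by auto
    have sub: "\<C> \<subseteq> \<A>" and comparable: "\<And>X Y. X \<in> \<C> \<Longrightarrow> Y \<in> \<C> \<Longrightarrow> X \<subseteq> Y \<or> Y \<subseteq> X"
      using ch by (simp_all add: subset_chain_def)
    have pc: "partial_character R S" "S0 \<subseteq> S" if "S \<in> \<C>" for S
      using subsetD[OF sub that] by (simp_all add: \<A>_def)
    have both: "\<exists>S\<in>\<C>. u \<in> S \<and> v \<in> S" if uv: "u \<in> \<Union>\<C>" "v \<in> \<Union>\<C>" for u v
    proof -
      obtain S S' where S: "S \<in> \<C>" "u \<in> S" "S' \<in> \<C>" "v \<in> S'" using uv by blast
      have "S \<subseteq> S' \<or> S' \<subseteq> S" using comparable S(1,3) by simp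
      then show ?thesis
      proof
        assume "S \<subseteq> S'"
        then show ?thesis using S(2-4) by (intro bexI[of _ S']) auto
      next
        assume "S' \<subseteq> S"
        then show ?thesis using S(1,2,4) by (intro bexI[of _ S]) auto
      qed
    qed
    have "partial_character R (\<Union>\<C>)"
      unfolding partial_character_def
    proof (intro conjI allI impI)
      show "\<Union>\<C> \<subseteq> carrier R \<times> (UNIV - {0})"
        by (rule Union_least) (rule partial_characterD(1)[OF pc(1)])
      show "(\<one>\<^bsub>R\<^esub>, 1) \<in> \<Union>\<C>"
        using partial_characterD(2)[OF pc(1)[OF S1]] S1 by (rule UnionI[rotated])
    next
      fix x z y w assume "(x, z) \<in> \<Union>\<C>" "(y, w) \<in> \<Union>\<C>"
      from both[OF this] obtain S where S: "S \<in> \<C>" "(x, z) \<in> S" "(y, w) \<in> S" by blast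
      show "(x \<otimes>\<^bsub>R\<^esub> y, z * w) \<in> \<Union>\<C>"
        using S(1) partial_characterD(3)[OF pc(1)[OF S(1)] S(2,3)] by (rule UnionI)
    next
      fix x z assume "(x, z) \<in> \<Union>\<C>"
      then obtain S where S: "S \<in> \<C>" "(x, z) \<in> S" by blast
      show "(inv\<^bsub>R\<^esub> x, inverse z) \<in> \<Union>\<C>"
        using S(1) partial_characterD(4)[OF pc(1)[OF S(1)] S(2)] by (rule UnionI)
    next
      fix z assume "(\<one>\<^bsub>R\<^esub>, z) \<in> \<Union>\<C>"
      then obtain S where S: "S \<in> \<C>" "(\<one>\<^bsub>R\<^esub>, z) \<in> S" by blast
      show "z = 1" using partial_characterD(5)[OF pc(1)[OF S(1)] S(2)] .
    qed
    then show "\<Union>\<C> \<in> \<A>" using pc(2)[OF S1] S1 by (auto simp: \<A>_def)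
  qed
  then obtain S where "S \<in> \<A>" and maximal: "\<forall>T\<in>\<A>. S \<subseteq> T \<longrightarrow> T = S" ..
  then have S: "partial_character R S" "S0 \<subseteq> S" by (simp_all add: \<A>_def)
  then have max: "T = S" if "partial_character R T" "S \<subseteq> T" for T
    using maximal that by (auto simp: \<A>_def)
  have total: "\<exists>z. (x, z) \<in> S" if x: "x \<in> carrier R" for x
  proof -
    obtain z where z: "z \<noteq> 0" "\<forall>i w. (x [^]\<^bsub>R\<^esub> (i::int), w) \<in> S \<longrightarrow> w = z powi i"
      using compatible_value_exists[OF assms(1) S(1) x] by (elim exE conjE)
    have "\<exists>T. partial_character R T \<and> S \<subseteq> T \<and> (x, z) \<in> T"
      by (rule partial_character_extend[OF assms(1) S(1) x z(1)]) (use z(2) in simp)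
    then obtain T where "partial_character R T" "S \<subseteq> T" "(x, z) \<in> T"
      by (elim exE conjE)
    then show ?thesis using max[of T] by (intro exI[of _ z]) simp
  qed
  define \<chi> where "\<chi> x = (THE z. (x, z) \<in> S)" for x
  note functional = partial_character_functional[OF is_group S(1)]
  have \<chi>: "\<chi> x = z" if "(x, z) \<in> S" for x z
    unfolding \<chi>_def using that functional[OF _ that] by (rule the_equality)
  have in_S: "(x, \<chi> x) \<in> S" if x: "x \<in> carrier R" for x
  proof -
    obtain z where "(x, z) \<in> S" using total[OF x] by blast
    then show ?thesis using \<chi>[of x z] by simp
  qed
  have "\<chi> \<in> hom R complex_units"
  proof (rule homI)
    fix x assume "x \<in> carrier R"
    then show "\<chi> x \<in> carrier complex_units"
      using subsetD[OF partial_characterD(1)[OF S(1)] in_S] by simp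
  next
    fix x y assume "x \<in> carrier R" "y \<in> carrier R"
    then have "(x \<otimes>\<^bsub>R\<^esub> y, \<chi> x * \<chi> y) \<in> S"
      using partial_characterD(3)[OF S(1)] in_S by simp
    then show "\<chi> (x \<otimes>\<^bsub>R\<^esub> y) = \<chi> x \<otimes>\<^bsub>complex_units\<^esub> \<chi> y"
      using \<chi> by simp
  qed
  moreover have "\<chi> a \<noteq> 1" using \<chi>[of a \<zeta>] S0(2) S(2) \<zeta>(2) by auto
  ultimately show thesis by (rule that)
qed

text \<open>Characters are cut off outside the carrier, so that a finite group has only finitely many of them as
functions.\<close>

definition characters :: "('a, 'm) monoid_scheme \<Rightarrow> ('a \<Rightarrow> complex) set"
  where "characters R = hom R complex_units \<inter> extensional (carrier R)"

lemma characters_iff: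
  "\<chi> \<in> characters R \<longleftrightarrow> \<chi> \<in> extensional (carrier R) \<and> (\<forall>x\<in>carrier R. \<chi> x \<noteq> 0) \<and>
    (\<forall>x\<in>carrier R. \<forall>y\<in>carrier R. \<chi> (x \<otimes>\<^bsub>R\<^esub> y) = \<chi> x * \<chi> y)"
  by (auto simp: characters_def hom_def)

text \<open>Double counting of \<open>\<Sum>\<^sub>\<chi> \<Sum>\<^sub>x \<chi>(x)\<close>. By the orthogonality relations only the trivial character contributes
when \<open>x\<close> is summed first, and only \<open>x = 1\<close> contributes when \<open>\<chi>\<close> is summed first; the latter relation is
where characters must separate points.\<close>

lemma card_characters:
  assumes "comm_group R" "finite (carrier R)" "finite (characters R)"
  shows "card (characters R) = card (carrier R)"
proof -
  interpret comm_group R by fact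
  have mult: "\<chi> (x \<otimes>\<^bsub>R\<^esub> y) = \<chi> x * \<chi> y" if "\<chi> \<in> characters R" "x \<in> carrier R" "y \<in> carrier R" for \<chi> x y
    using that by (simp add: characters_iff)
  have nz: "\<chi> x \<noteq> 0" if "\<chi> \<in> characters R" "x \<in> carrier R" for \<chi> x
    using that by (simp add: characters_iff)
  have one: "\<chi> \<one>\<^bsub>R\<^esub> = 1" if "\<chi> \<in> characters R" for \<chi>
    using mult[OF that, of "\<one>\<^bsub>R\<^esub>" "\<one>\<^bsub>R\<^esub>"] nz[OF that, of "\<one>\<^bsub>R\<^esub>"] by simp
  have prod_char: "(\<lambda>x\<in>carrier R. \<chi> x * \<psi> x) \<in> characters R"
    if "\<chi> \<in> characters R" "\<psi> \<in> characters R" for \<chi> \<psi>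
    using that by (simp add: characters_iff)
  have inv_char: "(\<lambda>x\<in>carrier R. inverse (\<chi> x)) \<in> characters R"
    if "\<chi> \<in> characters R" for \<chi>
    using that by (simp add: characters_iff)
  define \<epsilon> where "\<epsilon> = (\<lambda>x\<in>carrier R. 1 :: complex)"
  have \<epsilon>: "\<epsilon> \<in> characters R"
    unfolding \<epsilon>_def by (simp add: characters_iff)
  have sum_x: "(\<Sum>x\<in>carrier R. \<chi> x) = (if \<chi> = \<epsilon> then of_nat (card (carrier R)) else 0)"
    if \<chi>: "\<chi> \<in> characters R" for \<chi>
  proof (cases "\<chi> = \<epsilon>")
    case True
    then show ?thesis by (simp add: \<epsilon>_def)
  next
    case False
    have "\<exists>a\<in>carrier R. \<chi> a \<noteq> 1"
    proof (rule ccontr)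
      assume "\<not> (\<exists>a\<in>carrier R. \<chi> a \<noteq> 1)"
      then have "\<chi> = \<epsilon>"
        using \<chi> unfolding \<epsilon>_def characters_iff
        by (intro extensionalityI[of _ "carrier R"]) auto
      then show False using False by blast
    qed
    then obtain a where a: "a \<in> carrier R" "\<chi> a \<noteq> 1" by blast
    have "(\<Sum>x\<in>carrier R. \<chi> x) = (\<Sum>x\<in>carrier R. \<chi> (a \<otimes>\<^bsub>R\<^esub> x))"
      by (rule sum.reindex_bij_witness[of _ "\<lambda>x. a \<otimes>\<^bsub>R\<^esub> x" "\<lambda>x. inv\<^bsub>R\<^esub> a \<otimes>\<^bsub>R\<^esub> x"])
         (use a(1) in \<open>simp_all add: m_assoc[symmetric]\<close>)
    also have "\<dots> = \<chi> a * (\<Sum>x\<in>carrier R. \<chi> x)"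
      using mult[OF \<chi> a(1)] by (simp add: sum_distrib_left)
    finally have "(1 - \<chi> a) * (\<Sum>x\<in>carrier R. \<chi> x) = 0" by (simp add: algebra_simps)
    then show ?thesis using a False by simp
  qed
  have sum_\<chi>: "(\<Sum>\<chi>\<in>characters R. \<chi> x) = (if x = \<one>\<^bsub>R\<^esub> then of_nat (card (characters R)) else 0)"
    if x: "x \<in> carrier R" for x
  proof (cases "x = \<one>\<^bsub>R\<^esub>")
    case True
    have "(\<Sum>\<chi>\<in>characters R. \<chi> x) = (\<Sum>\<chi>\<in>characters R. 1)"
      using one True by (intro sum.cong) auto
    then show ?thesis using True by simp
  next
    case False
    obtain \<psi>0 where \<psi>0: "\<psi>0 \<in> hom R complex_units" "\<psi>0 x \<noteq> 1"
      using character_separating[OF assms(1) x False] .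
    define \<psi> where "\<psi> = restrict \<psi>0 (carrier R)"
    have \<psi>: "\<psi> \<in> characters R" "\<psi> x \<noteq> 1"
      using \<psi>0 x unfolding \<psi>_def characters_iff by (auto simp: hom_def)
    have "(\<Sum>\<chi>\<in>characters R. \<chi> x) = (\<Sum>\<chi>\<in>characters R. (\<lambda>y\<in>carrier R. \<psi> y * \<chi> y) x)"
    proof (rule sum.reindex_bij_witness[of _ "\<lambda>\<chi>. \<lambda>y\<in>carrier R. \<psi> y * \<chi> y"
          "\<lambda>\<chi>. \<lambda>y\<in>carrier R. (\<lambda>y\<in>carrier R. inverse (\<psi> y)) y * \<chi> y"])
      fix \<chi> assume \<chi>: "\<chi> \<in> characters R"
      show "(\<lambda>y\<in>carrier R. \<psi> y * \<chi> y) \<in> characters R"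
        using prod_char[OF \<psi>(1) \<chi>] .
      show "(\<lambda>y\<in>carrier R. (\<lambda>y\<in>carrier R. inverse (\<psi> y)) y * \<chi> y) \<in> characters R"
        using prod_char[OF inv_char[OF \<psi>(1)] \<chi>] .
      show "(\<lambda>y\<in>carrier R. \<psi> y * (\<lambda>y\<in>carrier R. (\<lambda>y\<in>carrier R. inverse (\<psi> y)) y * \<chi> y) y) = \<chi>"
        by (rule extensionalityI[of _ "carrier R"])
           (use \<chi> nz[OF \<psi>(1)] in \<open>simp_all add: characters_iff\<close>)
      show "(\<lambda>y\<in>carrier R. (\<lambda>y\<in>carrier R. inverse (\<psi> y)) y * (\<lambda>y\<in>carrier R. \<psi> y * \<chi> y) y) = \<chi>"
        by (rule extensionalityI[of _ "carrier R"])
           (use \<chi> nz[OF \<psi>(1)] in \<open>simp_all add: characters_iff\<close>)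
      show "(\<lambda>y\<in>carrier R. \<psi> y * (\<lambda>y\<in>carrier R. (\<lambda>y\<in>carrier R. inverse (\<psi> y)) y * \<chi> y) y) x = \<chi> x"
        using x nz[OF \<psi>(1)] by simp
    qed
    also have "\<dots> = \<psi> x * (\<Sum>\<chi>\<in>characters R. \<chi> x)"
      using x by (simp add: sum_distrib_left)
    finally have "(1 - \<psi> x) * (\<Sum>\<chi>\<in>characters R. \<chi> x) = 0" by (simp add: algebra_simps)
    then show ?thesis using \<psi>(2) False by simp
  qed
  have "(of_nat (card (carrier R)) :: complex) = (\<Sum>\<chi>\<in>characters R. \<Sum>x\<in>carrier R. \<chi> x)"
    using \<epsilon> assms(3) by (simp add: sum_x)
  also have "\<dots> = (\<Sum>x\<in>carrier R. \<Sum>\<chi>\<in>characters R. \<chi> x)"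
    by (rule sum.swap)
  also have "\<dots> = of_nat (card (characters R))"
    using assms(2) by (simp add: sum_\<chi>)
  finally show ?thesis by (simp only: of_nat_eq_iff)
qed

lemma complex_units_group: "group complex_units"
  using comm_group_complex_units by (rule comm_group.axioms(2))

section \<open>Finiteness of the Schur multiplier\<close>

lemma carrier_cochains2: "carrier (cochains2 G) = (\<Pi>\<^sub>E x\<in>carrier G \<times> carrier G. UNIV - {0})"
  by (simp add: cochains2_def)

lemma mult_cochains2: "mult (cochains2 G) = (\<lambda>f g. \<lambda>x\<in>carrier G \<times> carrier G. f x * g x)"
  by (simp add: cochains2_def)

lemma group_cochains2: "group (cochains2 G)"
  unfolding cochains2_def using complex_units_group by simp

lemma inv_cochains2:
  assumes "f \<in> carrier (cochains2 G)"
  shows "inv\<^bsub>cochains2 G\<^esub> f = (\<lambda>x\<in>carrier G \<times> carrier G. inverse (f x))"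
proof -
  have inv: "inv\<^bsub>complex_units\<^esub> z = inverse z" if "z \<noteq> 0" for z
    using that by (intro group.inv_equality[OF complex_units_group]) auto
  have "inv\<^bsub>cochains2 G\<^esub> f = (\<lambda>x\<in>carrier G \<times> carrier G. inv\<^bsub>complex_units\<^esub> f x)"
    using assms unfolding cochains2_def carrier_product_group
    by (rule inv_product_group) (rule complex_units_group)
  also have "\<dots> = (\<lambda>x\<in>carrier G \<times> carrier G. inverse (f x))"
    using assms by (intro restrict_ext inv) (auto simp: carrier_cochains2 PiE_iff)
  finally show ?thesis .
qed

definition coboundary :: "('a, 'm) monoid_scheme \<Rightarrow> ('a \<Rightarrow> complex) \<Rightarrow> 'a \<times> 'a \<Rightarrow> complex"
  where "coboundary G c = (\<lambda>(x, y) \<in> carrier G \<times> carrier G. c y * c x / c (x \<otimes>\<^bsub>G\<^esub> y))"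

lemma coboundaries2_iff:
  "f \<in> coboundaries2 G \<longleftrightarrow> (\<exists>c. (\<forall>x \<in> carrier G. c x \<noteq> 0) \<and> f = coboundary G c)"
  by (auto simp: coboundaries2_def coboundary_def)

lemma subgroup_coboundaries2:
  assumes "group G"
  shows "subgroup (coboundaries2 G) (cochains2 G)"
proof -
  interpret group G by fact
  have carrier: "coboundary G c \<in> carrier (cochains2 G)" if "\<forall>x \<in> carrier G. c x \<noteq> 0" for c
    using that by (auto simp: carrier_cochains2 coboundary_def)
  show ?thesis
  proof (rule group.subgroupI[OF group_cochains2])
    show "coboundaries2 G \<subseteq> carrier (cochains2 G)"
      using carrier by (auto simp: coboundaries2_iff)
    have "coboundary G (\<lambda>_. 1) \<in> coboundaries2 G"
      unfolding coboundaries2_iff by (intro exI[of _ "\<lambda>_. 1"]) simp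
    then show "coboundaries2 G \<noteq> {}" by blast
  next
    fix f assume "f \<in> coboundaries2 G"
    then obtain c where c: "\<forall>x \<in> carrier G. c x \<noteq> 0" "f = coboundary G c"
      by (auto simp: coboundaries2_iff)
    have "inv\<^bsub>cochains2 G\<^esub> f = coboundary G (\<lambda>x. inverse (c x))"
      unfolding c(2) inv_cochains2[OF carrier[OF c(1)]]
      using c(1) by (intro ext) (simp add: coboundary_def field_simps split: prod.split)
    then show "inv\<^bsub>cochains2 G\<^esub> f \<in> coboundaries2 G"
      unfolding coboundaries2_iff using c(1) by (intro exI[of _ "\<lambda>x. inverse (c x)"]) simp
  next
    fix f f' assume "f \<in> coboundaries2 G" "f' \<in> coboundaries2 G"
    then obtain c c' where c: "\<forall>x \<in> carrier G. c x \<noteq> 0" "f = coboundary G c"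
      "\<forall>x \<in> carrier G. c' x \<noteq> 0" "f' = coboundary G c'"
      by (auto simp: coboundaries2_iff)
    have "f \<otimes>\<^bsub>cochains2 G\<^esub> f' = coboundary G (\<lambda>x. c x * c' x)"
      unfolding c(2,4) mult_cochains2 by (rule ext) (simp add: coboundary_def split: prod.split)
    then show "f \<otimes>\<^bsub>cochains2 G\<^esub> f' \<in> coboundaries2 G"
      unfolding coboundaries2_iff using c by (intro exI[of _ "\<lambda>x. c x * c' x"]) simp
  qed
qed

definition cohomology_class :: "('a, 'm) monoid_scheme \<Rightarrow> ('a \<times> 'a \<Rightarrow> complex) \<Rightarrow> ('a \<times> 'a \<Rightarrow> complex) set"
  where "cohomology_class G f = coboundaries2 G #>\<^bsub>cochains2 G\<^esub> f"

lemma carrier_schur_multiplier: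
  "carrier (schur_multiplier G) = cohomology_class G ` cocycles2 G"
  unfolding schur_multiplier_def carrier_FactGroup cohomology_class_def
  by (simp add: r_coset_def)

text \<open>Translates equality of cosets into the existence of a cochain whose coboundary is the quotient; all later
arguments about classes are carried out with functions.\<close>

lemma cohomology_class_eq_iff:
  assumes "group G" "f \<in> carrier (cochains2 G)" "g \<in> carrier (cochains2 G)"
  shows "cohomology_class G f = cohomology_class G g \<longleftrightarrow>
    (\<exists>c. (\<forall>x\<in>carrier G. c x \<noteq> 0) \<and>
      (\<forall>x\<in>carrier G. \<forall>y\<in>carrier G. f (x, y) = c y * c x / c (x \<otimes>\<^bsub>G\<^esub> y) * g (x, y)))"
  (is "_ \<longleftrightarrow> ?R")
proof -
  interpret C: group "cochains2 G" by (rule group_cochains2)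
  note sub = subgroup_coboundaries2[OF assms(1)]
  have "cohomology_class G f = cohomology_class G g \<longleftrightarrow> f \<in> cohomology_class G g"
    unfolding cohomology_class_def
    using C.repr_independence[OF _ assms(3) sub, of f] C.rcos_self[OF assms(2) sub] by metis
  also have "\<dots> \<longleftrightarrow> ?R"
  proof
    assume "f \<in> cohomology_class G g"
    then obtain b where "b \<in> coboundaries2 G" "f = b \<otimes>\<^bsub>cochains2 G\<^esub> g"
      by (auto simp: cohomology_class_def r_coset_def)
    then show ?R
      by (auto simp: coboundaries2_iff mult_cochains2 coboundary_def)
  next
    assume ?R
    then obtain c where c: "\<forall>x\<in>carrier G. c x \<noteq> 0"
      "\<forall>x\<in>carrier G. \<forall>y\<in>carrier G. f (x, y) = c y * c x / c (x \<otimes>\<^bsub>G\<^esub> y) * g (x, y)"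
      by blast
    have "f = coboundary G c \<otimes>\<^bsub>cochains2 G\<^esub> g"
    proof (rule ext)
      fix x
      show "f x = (coboundary G c \<otimes>\<^bsub>cochains2 G\<^esub> g) x"
        using assms(2) c(2)
        by (cases x) (auto simp: mult_cochains2 coboundary_def carrier_cochains2 PiE_iff extensional_def)
    qed
    moreover have "coboundary G c \<in> coboundaries2 G"
      using c(1) by (auto simp: coboundaries2_iff)
    ultimately show "f \<in> cohomology_class G g"
      by (auto simp: cohomology_class_def r_coset_def)
  qed
  finally show ?thesis .
qed

text \<open>Multiplying the cocycle identity over the last variable shows that the \<open>m\<close>-th power of a cocycle \<open>f\<close>,
where \<open>m = |G|\<close>, is the coboundary of \<open>b(x) = \<Prod>\<^sub>z f(x, z)\<close>. If \<open>d\<close> is a pointwise \<open>m\<close>-th root of \<open>b\<close>, then \<open>f\<close>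
divided by the coboundary of \<open>d\<close> takes values in the \<open>m\<close>-th roots of unity. So every class is represented
by one of finitely many functions.\<close>

lemma finite_schur_multiplier:
  assumes "group G" "finite (carrier G)"
  shows "finite (carrier (schur_multiplier G))"
proof -
  interpret group G by fact
  define m where "m = card (carrier G)"
  have m: "m > 0" unfolding m_def using assms(2) by (auto simp: card_gt_0_iff)
  define T where "T = (carrier G \<times> carrier G \<rightarrow>\<^sub>E {z::complex. z ^ m = 1})"
  have T: "finite T"
    unfolding T_def using assms(2) m by (intro finite_PiE finite_nth_roots) auto
  have "cohomology_class G ` cocycles2 G \<subseteq> cohomology_class G ` T"
  proof (rule image_subsetI)
    fix f assume "f \<in> cocycles2 G"
    then have f: "f \<in> carrier (cochains2 G)"
      and cocycle: "\<And>x y z. x \<in> carrier G \<Longrightarrow> y \<in> carrier G \<Longrightarrow> z \<in> carrier G \<Longrightarrow>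
        f (y, z) * f (x, y \<otimes>\<^bsub>G\<^esub> z) = f (x \<otimes>\<^bsub>G\<^esub> y, z) * f (x, y)"
      by (auto simp: cocycles2_def)
    have nz: "f (x, y) \<noteq> 0" if "x \<in> carrier G" "y \<in> carrier G" for x y
      using f that by (auto simp: carrier_cochains2 PiE_iff)
    define b where "b x = (\<Prod>z\<in>carrier G. f (x, z))" for x
    have b_nz: "b x \<noteq> 0" if "x \<in> carrier G" for x
      unfolding b_def using nz that assms(2) by simp
    have b: "b y * b x = b (x \<otimes>\<^bsub>G\<^esub> y) * f (x, y) ^ m"
      if xy: "x \<in> carrier G" "y \<in> carrier G" for x y
    proof -
      have "b x = (\<Prod>z\<in>carrier G. f (x, y \<otimes>\<^bsub>G\<^esub> z))"
        unfolding b_def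
        by (rule prod.reindex_bij_witness[of _ "\<lambda>z. y \<otimes>\<^bsub>G\<^esub> z" "\<lambda>z. inv\<^bsub>G\<^esub> y \<otimes>\<^bsub>G\<^esub> z"])
           (use xy in \<open>simp_all add: m_assoc[symmetric]\<close>)
      then have "b y * b x = (\<Prod>z\<in>carrier G. f (y, z) * f (x, y \<otimes>\<^bsub>G\<^esub> z))"
        by (simp add: b_def prod.distrib)
      also have "\<dots> = (\<Prod>z\<in>carrier G. f (x \<otimes>\<^bsub>G\<^esub> y, z) * f (x, y))"
        using xy by (intro prod.cong refl cocycle)
      also have "\<dots> = b (x \<otimes>\<^bsub>G\<^esub> y) * f (x, y) ^ m"
        by (simp add: b_def prod.distrib m_def)
      finally show ?thesis .
    qed
    have "\<forall>x. \<exists>d. d ^ m = b x" using complex_nth_root_exists[OF m] by metis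
    then obtain d where d: "\<And>x. d x ^ m = b x" by metis
    have d_nz: "d x \<noteq> 0" if "x \<in> carrier G" for x
      using d[of x] b_nz[OF that] m by (metis zero_power)
    define g where "g = (\<lambda>(x, y)\<in>carrier G \<times> carrier G. f (x, y) * d (x \<otimes>\<^bsub>G\<^esub> y) / (d y * d x))"
    have "g (x, y) ^ m = 1" if "x \<in> carrier G" "y \<in> carrier G" for x y
    proof -
      have "g (x, y) ^ m = f (x, y) ^ m * b (x \<otimes>\<^bsub>G\<^esub> y) / (b y * b x)"
        using that by (simp add: g_def power_mult_distrib power_divide d)
      also have "\<dots> = 1"
        using b[OF that] b_nz that nz by (simp add: field_simps)
      finally show ?thesis .
    qed
    then have gT: "g \<in> T"
      unfolding T_def by (auto simp: g_def PiE_iff)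
    have g: "g \<in> carrier (cochains2 G)"
      using d_nz nz by (auto simp: carrier_cochains2 g_def)
    have "cohomology_class G f = cohomology_class G g"
      unfolding cohomology_class_eq_iff[OF assms(1) f g]
      by (intro exI[of _ d]) (auto simp: g_def d_nz)
    then show "cohomology_class G f \<in> cohomology_class G ` T" using gT by blast
  qed
  then show ?thesis
    unfolding carrier_schur_multiplier using T by (meson finite_imageI finite_subset)
qed

section \<open>Transgression\<close>

text \<open>For \<open>Z\<close> normal in \<open>X\<close> these are, up to values outside \<open>Z\<close>, the characters of \<open>Z/[X,Z]\<close>.\<close>

definition invariant_character :: "('x, 'p) monoid_scheme \<Rightarrow> 'x set \<Rightarrow> ('x \<Rightarrow> complex) \<Rightarrow> bool"
  where "invariant_character X Z \<chi> \<longleftrightarrow>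
    (\<forall>z\<in>Z. \<chi> z \<noteq> 0) \<and> (\<forall>z\<in>Z. \<forall>w\<in>Z. \<chi> (z \<otimes>\<^bsub>X\<^esub> w) = \<chi> z * \<chi> w) \<and>
    (\<forall>x\<in>carrier X. \<forall>z\<in>Z. \<chi> (x \<otimes>\<^bsub>X\<^esub> z \<otimes>\<^bsub>X\<^esub> inv\<^bsub>X\<^esub> x) = \<chi> z)"

text \<open>If \<open>s\<close> is a set-theoretic section of an epimorphism \<open>X \<rightarrow> G\<close>, this pushes the factor set of \<open>s\<close> forward
along a character of the kernel. Its class is the image of the character under the transgression map of the
five-term exact sequence for \<open>H\<^sup>*(-, \<complex>\<^sup>*)\<close>.\<close>

definition transgression ::
  "('x, 'p) monoid_scheme \<Rightarrow> ('a, 'm) monoid_scheme \<Rightarrow> ('a \<Rightarrow> 'x) \<Rightarrow> ('x \<Rightarrow> complex) \<Rightarrow> 'a \<times> 'a \<Rightarrow> complex"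
  where "transgression X G s \<chi> = (\<lambda>(g, h)\<in>carrier G \<times> carrier G.
    \<chi> (s g \<otimes>\<^bsub>X\<^esub> s h \<otimes>\<^bsub>X\<^esub> inv\<^bsub>X\<^esub> s (g \<otimes>\<^bsub>G\<^esub> h)))"

locale extension = group_hom X G q
  for X (structure) and G (structure) and q +
  fixes s
  assumes section_closed: "g \<in> carrier G \<Longrightarrow> s g \<in> carrier X"
    and section_inverse: "g \<in> carrier G \<Longrightarrow> q (s g) = g"
begin

abbreviation Z where "Z \<equiv> kernel X G q"

lemma in_kernel: "z \<in> Z \<longleftrightarrow> z \<in> carrier X \<and> q z = \<one>\<^bsub>G\<^esub>"
  by (simp add: kernel_def)

lemma inv_cancel_left [simp]:
  "x \<in> carrier X \<Longrightarrow> y \<in> carrier X \<Longrightarrow> inv\<^bsub>X\<^esub> x \<otimes>\<^bsub>X\<^esub> (x \<otimes>\<^bsub>X\<^esub> y) = y"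
  by (simp flip: G.m_assoc)

lemma factor_set_in_kernel:
  assumes "g \<in> carrier G" "h \<in> carrier G"
  shows "s g \<otimes>\<^bsub>X\<^esub> s h \<otimes>\<^bsub>X\<^esub> inv\<^bsub>X\<^esub> s (g \<otimes>\<^bsub>G\<^esub> h) \<in> Z"
  using assms by (simp add: in_kernel section_inverse section_closed)

lemma conj_in_kernel:
  assumes "x \<in> carrier X" "z \<in> Z"
  shows "x \<otimes>\<^bsub>X\<^esub> z \<otimes>\<^bsub>X\<^esub> inv\<^bsub>X\<^esub> x \<in> Z"
  using assms by (simp add: in_kernel)

text \<open>Both ways of bringing \<open>s g s h s l\<close> into the form of an element of the kernel times \<open>s(ghl)\<close> agree; moving
the kernel element past \<open>s g\<close> costs a conjugation, which an invariant character does not see.\<close>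

lemma transgression_cocycle:
  assumes \<chi>: "invariant_character X Z \<chi>"
  shows "transgression X G s \<chi> \<in> cocycles2 G"
proof -
  let ?k = "\<lambda>g h. s g \<otimes>\<^bsub>X\<^esub> s h \<otimes>\<^bsub>X\<^esub> inv\<^bsub>X\<^esub> s (g \<otimes>\<^bsub>G\<^esub> h)"
  note k = factor_set_in_kernel
  have "transgression X G s \<chi> \<in> carrier (cochains2 G)"
    using \<chi> k by (auto simp: carrier_cochains2 transgression_def invariant_character_def)
  moreover have "\<chi> (?k h l) * \<chi> (?k g (h \<otimes>\<^bsub>G\<^esub> l)) = \<chi> (?k (g \<otimes>\<^bsub>G\<^esub> h) l) * \<chi> (?k g h)"
    if gs: "g \<in> carrier G" "h \<in> carrier G" "l \<in> carrier G" for g h l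
  proof -
    have "(s g \<otimes>\<^bsub>X\<^esub> ?k h l \<otimes>\<^bsub>X\<^esub> inv\<^bsub>X\<^esub> s g) \<otimes>\<^bsub>X\<^esub> ?k g (h \<otimes>\<^bsub>G\<^esub> l) = ?k g h \<otimes>\<^bsub>X\<^esub> ?k (g \<otimes>\<^bsub>G\<^esub> h) l"
      using gs by (simp add: G.m_assoc H.m_assoc section_closed)
    then have "\<chi> ((s g \<otimes>\<^bsub>X\<^esub> ?k h l \<otimes>\<^bsub>X\<^esub> inv\<^bsub>X\<^esub> s g) \<otimes>\<^bsub>X\<^esub> ?k g (h \<otimes>\<^bsub>G\<^esub> l)) = \<chi> (?k g h \<otimes>\<^bsub>X\<^esub> ?k (g \<otimes>\<^bsub>G\<^esub> h) l)"
      by (rule arg_cong)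
    moreover have "?k h l \<in> Z" "?k g (h \<otimes>\<^bsub>G\<^esub> l) \<in> Z" "?k g h \<in> Z" "?k (g \<otimes>\<^bsub>G\<^esub> h) l \<in> Z"
      "s g \<otimes>\<^bsub>X\<^esub> ?k h l \<otimes>\<^bsub>X\<^esub> inv\<^bsub>X\<^esub> s g \<in> Z" "s g \<in> carrier X"
      using gs by (simp_all add: k conj_in_kernel section_closed)
    ultimately show ?thesis
      using \<chi> unfolding invariant_character_def by (simp add: mult.commute)
  qed
  ultimately show ?thesis
    by (simp add: cocycles2_def transgression_def)
qed

text \<open>If the transgression of \<open>\<chi>\<close> is the coboundary of \<open>c\<close>, then \<open>\<chi>\<close> extends to a homomorphism \<open>\<psi> : X \<rightarrow> \<complex>\<^sup>*\<close>,
namely \<open>\<psi>(z s(g)) = \<chi>(z) c(g)\<close>. A homomorphism into an abelian group is trivial on commutators.\<close>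

lemma character_trivial_if_transgression_coboundary:
  assumes \<chi>: "invariant_character X Z \<chi>"
    and c: "\<And>g. g \<in> carrier G \<Longrightarrow> c g \<noteq> 0"
      "\<And>g h. g \<in> carrier G \<Longrightarrow> h \<in> carrier G \<Longrightarrow>
        transgression X G s \<chi> (g, h) = c h * c g / c (g \<otimes>\<^bsub>G\<^esub> h)"
    and z: "z \<in> Z" "z \<in> derived X (carrier X)"
  shows "\<chi> z = 1"
proof -
  let ?k = "\<lambda>g h. s g \<otimes>\<^bsub>X\<^esub> s h \<otimes>\<^bsub>X\<^esub> inv\<^bsub>X\<^esub> s (g \<otimes>\<^bsub>G\<^esub> h)"
  define u where "u x = x \<otimes>\<^bsub>X\<^esub> inv\<^bsub>X\<^esub> s (q x)" for x
  \<comment> \<open>Every \<open>x\<close> is \<open>u x\<close> times a value of the section.\<close>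
  define \<psi> where "\<psi> x = \<chi> (u x) * c (q x)" for x
  have \<chi>_nz: "\<chi> w \<noteq> 0" if "w \<in> Z" for w
    using \<chi> that by (simp add: invariant_character_def)
  have \<chi>_mult: "\<chi> (v \<otimes>\<^bsub>X\<^esub> w) = \<chi> v * \<chi> w" if "v \<in> Z" "w \<in> Z" for v w
    using \<chi> that by (simp add: invariant_character_def)
  have \<chi>_conj: "\<chi> (x \<otimes>\<^bsub>X\<^esub> w \<otimes>\<^bsub>X\<^esub> inv\<^bsub>X\<^esub> x) = \<chi> w" if "x \<in> carrier X" "w \<in> Z" for x w
    using \<chi> that by (simp add: invariant_character_def)
  have Z_closed: "v \<otimes>\<^bsub>X\<^esub> w \<in> Z" if "v \<in> Z" "w \<in> Z" for v w
    using that by (simp add: in_kernel)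
  have u: "u x \<in> Z" if "x \<in> carrier X" for x
    using that by (simp add: u_def in_kernel section_inverse section_closed)
  have "\<psi> \<in> hom X complex_units"
  proof (rule homI)
    fix x assume "x \<in> carrier X"
    then show "\<psi> x \<in> carrier complex_units"
      by (simp add: \<psi>_def \<chi>_nz u c(1))
  next
    fix x y assume xy: "x \<in> carrier X" "y \<in> carrier X"
    let ?g = "q x" and ?h = "q y"
    have gh: "?g \<in> carrier G" "?h \<in> carrier G" using xy by simp_all
    have "u (x \<otimes>\<^bsub>X\<^esub> y) = u x \<otimes>\<^bsub>X\<^esub> (s ?g \<otimes>\<^bsub>X\<^esub> u y \<otimes>\<^bsub>X\<^esub> inv\<^bsub>X\<^esub> s ?g) \<otimes>\<^bsub>X\<^esub> ?k ?g ?h"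
      using xy by (simp add: u_def G.m_assoc section_closed)
    then have "\<chi> (u (x \<otimes>\<^bsub>X\<^esub> y)) = \<chi> (u x) * \<chi> (u y) * \<chi> (?k ?g ?h)"
      using u[OF xy(1)] u[OF xy(2)] section_closed[OF gh(1)] factor_set_in_kernel[OF gh]
      by (simp add: \<chi>_mult \<chi>_conj Z_closed conj_in_kernel)
    also have "\<chi> (?k ?g ?h) = c ?h * c ?g / c (?g \<otimes>\<^bsub>G\<^esub> ?h)"
      using c(2)[OF gh] gh by (simp add: transgression_def)
    finally show "\<psi> (x \<otimes>\<^bsub>X\<^esub> y) = \<psi> x \<otimes>\<^bsub>complex_units\<^esub> \<psi> y"
      using xy c(1)[of "?g \<otimes>\<^bsub>G\<^esub> ?h"] gh by (simp add: \<psi>_def)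
  qed
  then interpret \<psi>: group_hom X complex_units \<psi>
    by (simp add: group_hom_def group_hom_axioms_def complex_units_group)
  have s1: "s \<one>\<^bsub>G\<^esub> \<in> Z" by (simp add: in_kernel section_inverse section_closed)
  \<comment> \<open>The section need not send \<open>1\<close> to \<open>1\<close>; the value of \<open>c\<close> at \<open>1\<close> compensates for this.\<close>
  have "c \<one>\<^bsub>G\<^esub> = \<chi> (s \<one>\<^bsub>G\<^esub>)"
    using c(2)[of "\<one>\<^bsub>G\<^esub>" "\<one>\<^bsub>G\<^esub>"] c(1)[of "\<one>\<^bsub>G\<^esub>"] section_closed[of "\<one>\<^bsub>G\<^esub>"]
    by (simp add: transgression_def G.m_assoc)
  moreover have "\<chi> (u z) * \<chi> (s \<one>\<^bsub>G\<^esub>) = \<chi> z"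
    using \<chi>_mult[OF u s1, of z] z(1) section_closed[of "\<one>\<^bsub>G\<^esub>"]
    by (simp add: in_kernel u_def G.m_assoc)
  ultimately have "\<psi> z = \<chi> z"
    using z(1) by (simp add: \<psi>_def in_kernel)
  moreover have "\<psi> z \<in> derived complex_units (\<psi> ` carrier X)"
    using \<psi>.derived_img[of "carrier X"] z(2) by simp
  then have "\<psi> z = 1"
    using comm_group.derived_eq_singleton[OF comm_group_complex_units, of "\<psi> ` carrier X"]
      \<psi>.hom_closed by (auto simp: image_subset_iff)
  ultimately show ?thesis by simp
qed

text \<open>Transgression is multiplicative in the character, so the preceding lemma applies to \<open>\<chi>/\<chi>'\<close>.\<close>

lemma characters_agree_if_transgressions_cohomologous:
  assumes \<chi>: "invariant_character X Z \<chi>" and \<chi>': "invariant_character X Z \<chi>'"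
    and eq: "cohomology_class G (transgression X G s \<chi>) = cohomology_class G (transgression X G s \<chi>')"
    and z: "z \<in> Z" "z \<in> derived X (carrier X)"
  shows "\<chi> z = \<chi>' z"
proof -
  have "transgression X G s \<chi> \<in> carrier (cochains2 G)" "transgression X G s \<chi>' \<in> carrier (cochains2 G)"
    using transgression_cocycle \<chi> \<chi>' by (auto simp: cocycles2_def)
  from iffD1[OF cohomology_class_eq_iff[OF H.is_group this] eq]
  obtain c where c: "\<forall>x\<in>carrier G. c x \<noteq> 0"
    "\<forall>x\<in>carrier G. \<forall>y\<in>carrier G. transgression X G s \<chi> (x, y) =
      c y * c x / c (x \<otimes>\<^bsub>G\<^esub> y) * transgression X G s \<chi>' (x, y)" by blast
  have nz: "\<chi>' w \<noteq> 0" if "w \<in> Z" for w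
    using \<chi>' that by (simp add: invariant_character_def)
  have "invariant_character X Z (\<lambda>w. \<chi> w / \<chi>' w)"
    using \<chi> \<chi>' by (simp add: invariant_character_def)
  moreover have "transgression X G s (\<lambda>w. \<chi> w / \<chi>' w) (g, h) = c h * c g / c (g \<otimes>\<^bsub>G\<^esub> h)"
    if "g \<in> carrier G" "h \<in> carrier G" for g h
    using c(2) that nz[OF factor_set_in_kernel[OF that]] by (simp add: transgression_def)
  ultimately have "\<chi> z / \<chi>' z = 1"
    using c(1) z by (intro character_trivial_if_transgression_coboundary[where \<chi> = "\<lambda>w. \<chi> w / \<chi>' w"]) auto
  then show ?thesis using nz[OF z(1)] by simp
qed

end

section \<open>Characters of the kernel of a cover\<close>

text \<open>For a cover, transgression is injective because \<open>M\<close> lies in the derived subgroup. The set of characters of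
\<open>M\<close> has as many elements as \<open>M\<close>, and \<open>M\<close> as many as the finite group \<open>H\<^sup>2(G, \<complex>\<^sup>*)\<close>; hence transgression is
also surjective. This is the only use of the isomorphism between \<open>M\<close> and the Schur multiplier.\<close>

lemma cohomology_class_transgression_bij:
  assumes "group G" "finite (carrier G)" "is_cover G E p"
    and s: "\<And>g. g \<in> carrier G \<Longrightarrow> s g \<in> carrier E" "\<And>g. g \<in> carrier G \<Longrightarrow> p (s g) = g"
  shows "bij_betw (\<lambda>\<mu>. cohomology_class G (transgression E G s \<mu>))
    (characters (subgroup_of E (kernel E G p))) (carrier (schur_multiplier G))"
proof -
  define M where "M = kernel E G p"
  let ?\<tau> = "\<lambda>\<mu>. cohomology_class G (transgression E G s \<mu>)"
  have E: "group E" "p \<in> hom E G" "M \<subseteq> center E" "M \<subseteq> derived E (carrier E)"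
    "subgroup_of E M \<cong> schur_multiplier G"
    using assms(3) by (auto simp: is_cover_def epi_def M_def)
  interpret extension E G p s
    using assms(1) E(1,2) s
    by (simp add: extension_def extension_axioms_def group_hom_def group_hom_axioms_def)
  have sub: "subgroup M E" unfolding M_def by (rule subgroup_kernel)
  have ME: "x \<in> carrier E" if "x \<in> M" for x using subgroup.mem_carrier[OF sub that] .
  have central: "x \<otimes>\<^bsub>E\<^esub> y = y \<otimes>\<^bsub>E\<^esub> x" if "x \<in> M" "y \<in> carrier E" for x y
    using E(3) that by (auto simp: center_def)
  have "comm_group (subgroup_of E M)"
    using subgroup.subgroup_is_group[OF sub G.is_group] central ME
    by (intro group.group_comm_groupI) simp_all
  have inv: "invariant_character E M \<mu>" if "\<mu> \<in> characters (subgroup_of E M)" for \<mu>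
    unfolding invariant_character_def
  proof (intro conjI ballI)
    fix x z assume xz: "x \<in> carrier E" "z \<in> M"
    have "x \<otimes>\<^bsub>E\<^esub> z \<otimes>\<^bsub>E\<^esub> inv\<^bsub>E\<^esub> x = z"
      using xz ME central[OF xz(2,1), symmetric] by (simp add: G.m_assoc)
    then show "\<mu> (x \<otimes>\<^bsub>E\<^esub> z \<otimes>\<^bsub>E\<^esub> inv\<^bsub>E\<^esub> x) = \<mu> z" by simp
  qed (use that in \<open>simp_all add: characters_iff\<close>)
  have inj: "inj_on ?\<tau> (characters (subgroup_of E M))"
  proof (rule inj_onI)
    fix \<mu> \<nu>
    assume \<mu>: "\<mu> \<in> characters (subgroup_of E M)" and \<nu>: "\<nu> \<in> characters (subgroup_of E M)"
      and eq: "?\<tau> \<mu> = ?\<tau> \<nu>"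
    have "\<mu> z = \<nu> z" if "z \<in> M" for z
      using characters_agree_if_transgressions_cohomologous[of \<mu> \<nu> z] inv[OF \<mu>] inv[OF \<nu>] eq that E(4)
      unfolding M_def by blast
    then show "\<mu> = \<nu>"
      using \<mu> \<nu> by (intro extensionalityI[of _ M]) (auto simp: characters_iff)
  qed
  have image: "?\<tau> ` characters (subgroup_of E M) \<subseteq> carrier (schur_multiplier G)"
    using transgression_cocycle inv unfolding carrier_schur_multiplier M_def by blast
  have fin: "finite (carrier (schur_multiplier G))"
    using assms(1,2) by (rule finite_schur_multiplier)
  have "\<exists>h. bij_betw h M (carrier (schur_multiplier G))"
    using E(5) by (auto simp: is_iso_def iso_def)
  then have M: "finite M" "card M = card (carrier (schur_multiplier G))"
    using fin bij_betw_finite bij_betw_same_card by blast+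
  have fin_char: "finite (characters (subgroup_of E M))"
    using inj_on_finite[OF inj image fin] .
  have "card (?\<tau> ` characters (subgroup_of E M)) = card (carrier (schur_multiplier G))"
    using card_image[OF inj] card_characters[OF \<open>comm_group (subgroup_of E M)\<close> _ fin_char] M by simp
  then have "?\<tau> ` characters (subgroup_of E M) = carrier (schur_multiplier G)"
    by (rule card_subset_eq[OF fin image])
  then show ?thesis using inj unfolding bij_betw_def M_def by blast
qed

text \<open>The transgression of \<open>\<chi>\<close> is cohomologous to that of some character \<open>\<mu>\<close> of \<open>M\<close>, and the latter is also the
transgression of \<open>\<mu> \<circ> \<Phi>\<close> if the section of \<open>p\<close> is chosen to factor through \<open>\<Phi>\<close>. Hence \<open>\<chi>\<close> and \<open>\<mu> \<circ> \<Phi>\<close> agree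
on elements of the kernel that lie in the derived subgroup.\<close>

lemma invariant_character_trivial_on_kernel_in_derived:
  assumes "group G" "finite (carrier G)" "is_cover G E p"
    and "group F" "\<Phi> \<in> hom F E" "p \<circ> \<Phi> \<in> epi F G"
    and \<chi>: "invariant_character F (kernel F G (p \<circ> \<Phi>)) \<chi>"
    and a: "a \<in> derived F (carrier F)" "\<Phi> a = \<one>\<^bsub>E\<^esub>"
  shows "\<chi> a = 1"
proof -
  define s where "s = inv_into (carrier F) (p \<circ> \<Phi>)"
  have "(p \<circ> \<Phi>) ` carrier F = carrier G" "p \<circ> \<Phi> \<in> hom F G" using assms(6) by (auto simp: epi_def)
  then have s: "s g \<in> carrier F" "(p \<circ> \<Phi>) (s g) = g" if "g \<in> carrier G" for g
    using that unfolding s_def by (metis inv_into_into, metis f_inv_into_f)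
  have E: "group E" "p \<in> hom E G" "kernel E G p \<subseteq> center E"
    using assms(3) by (auto simp: is_cover_def epi_def)
  interpret F: extension F G "p \<circ> \<Phi>" s
    using assms(1,4) s \<open>p \<circ> \<Phi> \<in> hom F G\<close>
    by (simp add: extension_def extension_axioms_def group_hom_def group_hom_axioms_def)
  interpret \<Phi>: group_hom F E \<Phi>
    using assms(4,5) E(1) by (simp add: group_hom_def group_hom_axioms_def)
  interpret p: group_hom E G p
    using assms(1) E by (simp add: group_hom_def group_hom_axioms_def)
  have "cohomology_class G (transgression F G s \<chi>) \<in> carrier (schur_multiplier G)"
    unfolding carrier_schur_multiplier using F.transgression_cocycle[OF \<chi>] by (rule imageI)
  moreover have "bij_betw (\<lambda>\<mu>. cohomology_class G (transgression E G (\<Phi> \<circ> s) \<mu>))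
    (characters (subgroup_of E (kernel E G p))) (carrier (schur_multiplier G))"
    using assms(1-3) by (rule cohomology_class_transgression_bij) (use s in auto)
  ultimately obtain \<mu> where \<mu>: "\<mu> \<in> characters (subgroup_of E (kernel E G p))"
    and eq: "cohomology_class G (transgression F G s \<chi>) =
      cohomology_class G (transgression E G (\<Phi> \<circ> s) \<mu>)"
    unfolding bij_betw_def by blast
  have "transgression E G (\<Phi> \<circ> s) \<mu> = transgression F G s (\<mu> \<circ> \<Phi>)"
    by (rule ext) (use s in \<open>auto simp: transgression_def\<close>)
  moreover have "invariant_character F (kernel F G (p \<circ> \<Phi>)) (\<mu> \<circ> \<Phi>)"
    unfolding invariant_character_def
  proof (intro conjI ballI)
    fix x z assume xz: "x \<in> carrier F" "z \<in> kernel F G (p \<circ> \<Phi>)"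
    then have "z \<in> carrier F" "\<Phi> z \<in> kernel E G p" by (auto simp: kernel_def)
    then have "\<Phi> z \<otimes>\<^bsub>E\<^esub> \<Phi> x = \<Phi> x \<otimes>\<^bsub>E\<^esub> \<Phi> z"
      using E(3) xz(1) by (auto simp: center_def)
    then have "\<Phi> (x \<otimes>\<^bsub>F\<^esub> z \<otimes>\<^bsub>F\<^esub> inv\<^bsub>F\<^esub> x) = \<Phi> z"
      using xz(1) \<open>z \<in> carrier F\<close> by (simp flip: \<open>\<Phi> z \<otimes>\<^bsub>E\<^esub> \<Phi> x = _\<close> add: \<Phi>.H.m_assoc)
    then show "(\<mu> \<circ> \<Phi>) (x \<otimes>\<^bsub>F\<^esub> z \<otimes>\<^bsub>F\<^esub> inv\<^bsub>F\<^esub> x) = (\<mu> \<circ> \<Phi>) z" by simp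
  qed (use \<mu> in \<open>auto simp: characters_iff kernel_def\<close>)
  moreover have "a \<in> carrier F"
    using a(1) F.G.derived_in_carrier by blast
  then have "a \<in> kernel F G (p \<circ> \<Phi>)"
    using a(2) by (simp add: kernel_def)
  ultimately have "\<chi> a = (\<mu> \<circ> \<Phi>) a"
    using F.characters_agree_if_transgressions_cohomologous[OF \<chi>] eq a(1) by metis
  also have "\<dots> = 1"
  proof -
    have "\<one>\<^bsub>E\<^esub> \<in> kernel E G p" by (simp add: kernel_def)
    moreover have "\<forall>x\<in>kernel E G p. \<mu> x \<noteq> 0"
      "\<forall>x\<in>kernel E G p. \<forall>y\<in>kernel E G p. \<mu> (x \<otimes>\<^bsub>E\<^esub> y) = \<mu> x * \<mu> y"
      using \<mu> by (simp_all add: characters_iff)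
    ultimately have "\<mu> \<one>\<^bsub>E\<^esub> \<noteq> 0" "\<mu> (\<one>\<^bsub>E\<^esub> \<otimes>\<^bsub>E\<^esub> \<one>\<^bsub>E\<^esub>) = \<mu> \<one>\<^bsub>E\<^esub> * \<mu> \<one>\<^bsub>E\<^esub>"
      by blast+
    then show ?thesis using a(2) by simp
  qed
  finally show ?thesis .
qed

definition mixed_commutator :: "('x, 'p) monoid_scheme \<Rightarrow> 'x set \<Rightarrow> 'x set"
  where "mixed_commutator F N = generate F
    {f \<otimes>\<^bsub>F\<^esub> x \<otimes>\<^bsub>F\<^esub> inv\<^bsub>F\<^esub> f \<otimes>\<^bsub>F\<^esub> inv\<^bsub>F\<^esub> x | f x. f \<in> carrier F \<and> x \<in> N}"

text \<open>The quotient \<open>N/[F,N]\<close> is abelian, so its characters separate points; pulled back to \<open>N\<close> they are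
invariant under conjugation by \<open>F\<close>.\<close>

lemma invariant_character_detects_mixed_commutator:
  assumes "N \<lhd> F" "a \<in> N" "a \<notin> mixed_commutator F N"
  shows "\<exists>\<chi>. invariant_character F N \<chi> \<and> \<chi> a \<noteq> 1"
proof -
  define C where "C = mixed_commutator F N"
  interpret N: normal N F by fact
  let ?D = "{f \<otimes>\<^bsub>F\<^esub> x \<otimes>\<^bsub>F\<^esub> inv\<^bsub>F\<^esub> f \<otimes>\<^bsub>F\<^esub> inv\<^bsub>F\<^esub> x | f x. f \<in> carrier F \<and> x \<in> N}"
  have cancel: "inv\<^bsub>F\<^esub> x \<otimes>\<^bsub>F\<^esub> (x \<otimes>\<^bsub>F\<^esub> y) = y" if "x \<in> carrier F" "y \<in> carrier F" for x y
    using that by (simp flip: N.m_assoc)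
  have conj: "f \<otimes>\<^bsub>F\<^esub> x \<otimes>\<^bsub>F\<^esub> inv\<^bsub>F\<^esub> f \<in> N" if "f \<in> carrier F" "x \<in> N" for f x
    using that by (rule N.inv_op_closed2)
  have "?D \<subseteq> N" using conj by auto
  then have "?D \<subseteq> carrier F" using N.subset by blast
  have "C \<lhd> F"
    unfolding C_def mixed_commutator_def
  proof (rule N.normal_generateI[OF \<open>?D \<subseteq> carrier F\<close>])
    fix h g assume "h \<in> ?D" and g: "g \<in> carrier F"
    then obtain f x where fx: "f \<in> carrier F" "x \<in> N" "h = f \<otimes>\<^bsub>F\<^esub> x \<otimes>\<^bsub>F\<^esub> inv\<^bsub>F\<^esub> f \<otimes>\<^bsub>F\<^esub> inv\<^bsub>F\<^esub> x" by blast
    let ?f = "g \<otimes>\<^bsub>F\<^esub> f \<otimes>\<^bsub>F\<^esub> inv\<^bsub>F\<^esub> g" and ?x = "g \<otimes>\<^bsub>F\<^esub> x \<otimes>\<^bsub>F\<^esub> inv\<^bsub>F\<^esub> g"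
    have "g \<otimes>\<^bsub>F\<^esub> h \<otimes>\<^bsub>F\<^esub> inv\<^bsub>F\<^esub> g = ?f \<otimes>\<^bsub>F\<^esub> ?x \<otimes>\<^bsub>F\<^esub> inv\<^bsub>F\<^esub> ?f \<otimes>\<^bsub>F\<^esub> inv\<^bsub>F\<^esub> ?x"
      using fx g by (simp add: N.m_assoc N.inv_mult_group cancel)
    moreover have "?f \<in> carrier F" "?x \<in> N" using fx g conj by simp_all
    ultimately show "g \<otimes>\<^bsub>F\<^esub> h \<otimes>\<^bsub>F\<^esub> inv\<^bsub>F\<^esub> g \<in> ?D" by blast
  qed
  then have subC: "subgroup C F" by (rule normal_imp_subgroup)
  have "C \<subseteq> N"
    unfolding C_def mixed_commutator_def
    using \<open>?D \<subseteq> N\<close> N.is_subgroup by (rule N.generate_subgroup_incl)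
  let ?FN = "subgroup_of F N" and ?R = "subgroup_of F N Mod C"
  have grpN: "group ?FN" by (rule N.subgroup_is_group) (rule N.is_group)
  have "C \<lhd> ?FN"
    using N.normal_restrict_supergroup[OF N.is_subgroup \<open>C \<lhd> F\<close> \<open>C \<subseteq> N\<close>] .
  then interpret C: normal C ?FN .
  have coset: "C #>\<^bsub>?FN\<^esub> x = C #>\<^bsub>F\<^esub> x" for x by (simp add: r_coset_def)
  have swap: "C #>\<^bsub>F\<^esub> (f \<otimes>\<^bsub>F\<^esub> x) = C #>\<^bsub>F\<^esub> (x \<otimes>\<^bsub>F\<^esub> f)" if fx: "f \<in> carrier F" "x \<in> N" for f x
  proof -
    have "f \<otimes>\<^bsub>F\<^esub> x \<otimes>\<^bsub>F\<^esub> inv\<^bsub>F\<^esub> f \<otimes>\<^bsub>F\<^esub> inv\<^bsub>F\<^esub> x \<in> C"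
      unfolding C_def mixed_commutator_def using fx by (intro generate.incl) blast
    moreover have "f \<otimes>\<^bsub>F\<^esub> x = (f \<otimes>\<^bsub>F\<^esub> x \<otimes>\<^bsub>F\<^esub> inv\<^bsub>F\<^esub> f \<otimes>\<^bsub>F\<^esub> inv\<^bsub>F\<^esub> x) \<otimes>\<^bsub>F\<^esub> (x \<otimes>\<^bsub>F\<^esub> f)"
      using fx by (simp add: N.m_assoc cancel)
    ultimately have "f \<otimes>\<^bsub>F\<^esub> x \<in> C #>\<^bsub>F\<^esub> (x \<otimes>\<^bsub>F\<^esub> f)"
      unfolding r_coset_def by blast
    then show ?thesis
      using N.repr_independence[OF _ _ subC] fx by simp
  qed
  have "comm_group ?R"
  proof (rule group.group_comm_groupI[OF C.factorgroup_is_group])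
    fix u v assume "u \<in> carrier ?R" "v \<in> carrier ?R"
    then obtain x y where xy: "x \<in> N" "u = C #>\<^bsub>?FN\<^esub> x" "y \<in> N" "v = C #>\<^bsub>?FN\<^esub> y"
      by (auto simp: carrier_FactGroup)
    have "u \<otimes>\<^bsub>?R\<^esub> v = C #>\<^bsub>?FN\<^esub> (x \<otimes>\<^bsub>F\<^esub> y)" "v \<otimes>\<^bsub>?R\<^esub> u = C #>\<^bsub>?FN\<^esub> (y \<otimes>\<^bsub>F\<^esub> x)"
      using C.rcos_sum[of x y] C.rcos_sum[of y x] xy by simp_all
    then show "u \<otimes>\<^bsub>?R\<^esub> v = v \<otimes>\<^bsub>?R\<^esub> u"
      using swap[of x y] xy by (simp add: coset)
  qed
  moreover have "C #>\<^bsub>?FN\<^esub> a \<in> carrier ?R"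
    using assms(2) by (auto simp: carrier_FactGroup)
  moreover have "C #>\<^bsub>?FN\<^esub> a \<noteq> \<one>\<^bsub>?R\<^esub>"
    using assms(3) C.rcos_self[of a C] assms(2) C.is_subgroup by (auto simp: C_def)
  ultimately obtain \<chi> where \<chi>: "\<chi> \<in> hom ?R complex_units" "\<chi> (C #>\<^bsub>?FN\<^esub> a) \<noteq> 1"
    by (rule character_separating)
  define \<psi> where "\<psi> x = \<chi> (C #>\<^bsub>?FN\<^esub> x)" for x
  have "invariant_character F N \<psi>"
    unfolding invariant_character_def
  proof (intro conjI ballI)
    fix z assume "z \<in> N"
    then have "C #>\<^bsub>?FN\<^esub> z \<in> carrier ?R" by (auto simp: carrier_FactGroup)
    then show "\<psi> z \<noteq> 0" using hom_carrier[OF \<chi>(1)] by (auto simp: \<psi>_def)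
  next
    fix z w assume zw: "z \<in> N" "w \<in> N"
    then have "C #>\<^bsub>?FN\<^esub> z \<in> carrier ?R" "C #>\<^bsub>?FN\<^esub> w \<in> carrier ?R" by (auto simp: carrier_FactGroup)
    from hom_mult[OF \<chi>(1) this] show "\<psi> (z \<otimes>\<^bsub>F\<^esub> w) = \<psi> z * \<psi> w"
      using C.rcos_sum[of z w] zw by (simp add: \<psi>_def)
  next
    fix x z assume xz: "x \<in> carrier F" "z \<in> N"
    have "x \<otimes>\<^bsub>F\<^esub> z \<otimes>\<^bsub>F\<^esub> inv\<^bsub>F\<^esub> x \<otimes>\<^bsub>F\<^esub> inv\<^bsub>F\<^esub> z \<in> C"
      unfolding C_def mixed_commutator_def using xz by (intro generate.incl) blast
    moreover have "x \<otimes>\<^bsub>F\<^esub> z \<otimes>\<^bsub>F\<^esub> inv\<^bsub>F\<^esub> x = (x \<otimes>\<^bsub>F\<^esub> z \<otimes>\<^bsub>F\<^esub> inv\<^bsub>F\<^esub> x \<otimes>\<^bsub>F\<^esub> inv\<^bsub>F\<^esub> z) \<otimes>\<^bsub>F\<^esub> z"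
      using xz by (simp add: N.m_assoc)
    ultimately have "x \<otimes>\<^bsub>F\<^esub> z \<otimes>\<^bsub>F\<^esub> inv\<^bsub>F\<^esub> x \<in> C #>\<^bsub>F\<^esub> z"
      unfolding r_coset_def by blast
    then have "C #>\<^bsub>F\<^esub> (x \<otimes>\<^bsub>F\<^esub> z \<otimes>\<^bsub>F\<^esub> inv\<^bsub>F\<^esub> x) = C #>\<^bsub>F\<^esub> z"
      using N.repr_independence[OF _ _ subC] xz by simp
    then show "\<psi> (x \<otimes>\<^bsub>F\<^esub> z \<otimes>\<^bsub>F\<^esub> inv\<^bsub>F\<^esub> x) = \<psi> z" by (simp add: \<psi>_def coset)
  qed
  then show ?thesis using \<chi>(2) unfolding \<psi>_def by blast
qed

text \<open>For \<open>F\<close> free, Hopf's formula identifies \<open>(N \<inter> [F,F])/[F,N]\<close> with \<open>H\<^sub>2(G, \<int>)\<close>, and this says that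
\<open>\<Phi>\<close> embeds that group into \<open>M\<close>. Every invariant character of \<open>N\<close> is trivial at \<open>a\<close>, so \<open>a\<close> lies in \<open>[F,N]\<close>.\<close>

proposition kernel_in_derived_subset_mixed_commutator:
  assumes "group G" "finite (carrier G)" "is_cover G E p"
    and "group F" "\<Phi> \<in> hom F E" "p \<circ> \<Phi> \<in> epi F G"
    and a: "a \<in> derived F (carrier F)" "\<Phi> a = \<one>\<^bsub>E\<^esub>"
  shows "a \<in> mixed_commutator F (kernel F G (p \<circ> \<Phi>))"
proof (rule ccontr)
  assume contra: "a \<notin> mixed_commutator F (kernel F G (p \<circ> \<Phi>))"
  interpret q: group_hom F G "p \<circ> \<Phi>"
    using assms(1,4,6) by (simp add: group_hom_def group_hom_axioms_def epi_def)
  interpret p: group_hom E G p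
    using assms(1,3) by (simp add: group_hom_def group_hom_axioms_def epi_def is_cover_def)
  have "a \<in> carrier F" using a(1) q.G.derived_in_carrier by blast
  then have "a \<in> kernel F G (p \<circ> \<Phi>)" using a(2) by (simp add: kernel_def)
  from invariant_character_detects_mixed_commutator[OF q.normal_kernel this contra]
  show False
    using invariant_character_trivial_on_kernel_in_derived[OF assms(1-6) _ a] by blast
qed

section \<open>Ordered products and the groups K\<close>

lemma (in group) ordered_prod_closed:
  assumes "\<And>i. i < n \<Longrightarrow> g i \<in> carrier G"
  shows "ordered_prod G n g \<in> carrier G"
proof -
  have "foldr (\<lambda>i x. g i \<otimes> x) xs \<one> \<in> carrier G" if "set xs \<subseteq> {..<n}" for xs
    using that assms by (induction xs) auto
  then show ?thesis by (simp add: ordered_prod_def lessThan_atLeast0)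
qed

lemma ordered_prod_cong:
  assumes "\<And>i. i < n \<Longrightarrow> f i = g i"
  shows "ordered_prod G n f = ordered_prod G n g"
  unfolding ordered_prod_def using assms by (intro foldr_cong) auto

lemma ordered_prod_subgroup_of [simp]: "ordered_prod (subgroup_of G H) = ordered_prod G"
  by (simp add: ordered_prod_def fun_eq_iff)

lemma (in group_hom) hom_ordered_prod:
  assumes "\<And>i. i < n \<Longrightarrow> g i \<in> carrier G"
  shows "h (ordered_prod G n g) = ordered_prod H n (\<lambda>i. h (g i))"
proof -
  have "foldr (\<lambda>i x. g i \<otimes> x) xs \<one> \<in> carrier G \<and>
    h (foldr (\<lambda>i x. g i \<otimes> x) xs \<one>) = foldr (\<lambda>i x. h (g i) \<otimes>\<^bsub>H\<^esub> x) xs \<one>\<^bsub>H\<^esub>"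
    if "set xs \<subseteq> {..<n}" for xs
    using that assms by (induction xs) auto
  then show ?thesis by (simp add: ordered_prod_def lessThan_atLeast0)
qed

lemma (in group) ordered_prod_mult_central:
  assumes f: "\<And>i. i < n \<Longrightarrow> f i \<in> carrier G" and g: "\<And>i. i < n \<Longrightarrow> g i \<in> carrier G"
    and central: "\<And>i x. i < n \<Longrightarrow> x \<in> carrier G \<Longrightarrow> f i \<otimes> x = x \<otimes> f i"
  shows "ordered_prod G n (\<lambda>i. f i \<otimes> g i) = ordered_prod G n f \<otimes> ordered_prod G n g"
proof -
  let ?p = "\<lambda>g xs. foldr (\<lambda>i x. g i \<otimes> x) xs \<one>"
  have "?p f xs \<in> carrier G \<and> ?p g xs \<in> carrier G \<and>
    (\<forall>x\<in>carrier G. ?p f xs \<otimes> x = x \<otimes> ?p f xs) \<and>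
    ?p (\<lambda>i. f i \<otimes> g i) xs = ?p f xs \<otimes> ?p g xs" if "set xs \<subseteq> {..<n}" for xs
    using that
  proof (induction xs)
    case (Cons i xs)
    then have IH: "?p f xs \<in> carrier G" "?p g xs \<in> carrier G"
      "\<And>x. x \<in> carrier G \<Longrightarrow> ?p f xs \<otimes> x = x \<otimes> ?p f xs"
      "?p (\<lambda>i. f i \<otimes> g i) xs = ?p f xs \<otimes> ?p g xs" and i: "i < n" by auto
    note c = f[OF i] g[OF i] IH(1,2)
    have "(f i \<otimes> ?p f xs) \<otimes> x = x \<otimes> (f i \<otimes> ?p f xs)" if x: "x \<in> carrier G" for x
    proof -
      have "(f i \<otimes> ?p f xs) \<otimes> x = f i \<otimes> (x \<otimes> ?p f xs)"
        using c x by (simp add: m_assoc IH(3))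
      also have "\<dots> = (f i \<otimes> x) \<otimes> ?p f xs" using c x by (simp add: m_assoc)
      also have "\<dots> = x \<otimes> (f i \<otimes> ?p f xs)" using c x by (simp add: central[OF i] m_assoc)
      finally show ?thesis .
    qed
    moreover have "(f i \<otimes> g i) \<otimes> (?p f xs \<otimes> ?p g xs) = (f i \<otimes> ?p f xs) \<otimes> (g i \<otimes> ?p g xs)"
    proof -
      have "(f i \<otimes> g i) \<otimes> (?p f xs \<otimes> ?p g xs) = f i \<otimes> ((g i \<otimes> ?p f xs) \<otimes> ?p g xs)"
        using c by (simp add: m_assoc)
      also have "g i \<otimes> ?p f xs = ?p f xs \<otimes> g i" using IH(3) c by simp
      finally show ?thesis using c by (simp add: m_assoc)
    qed
    ultimately show ?case using c IH(4) by simp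
  qed simp
  then show ?thesis by (simp add: ordered_prod_def lessThan_atLeast0)
qed

text \<open>Allows the product of a tuple to be corrected by changing its first entry only.\<close>

lemma (in group) ordered_prod_update_first:
  assumes "0 < n" "x \<in> carrier G" "\<And>i. i < n \<Longrightarrow> g i \<in> carrier G"
  shows "ordered_prod G n (g(0 := x \<otimes> g 0)) = x \<otimes> ordered_prod G n g"
proof -
  let ?t = "foldr (\<lambda>i x. g i \<otimes> x) [1..<n] \<one>"
  have "foldr (\<lambda>i x. g i \<otimes> x) xs \<one> \<in> carrier G" if "set xs \<subseteq> {..<n}" for xs
    using that assms by (induction xs) auto
  from this[of "[1..<n]"] have t: "?t \<in> carrier G" by force
  have tail: "foldr (\<lambda>i y. (g(0 := x \<otimes> g 0)) i \<otimes> y) [1..<n] \<one> = ?t"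
    by (rule foldr_cong) auto
  have "ordered_prod G n (g(0 := x \<otimes> g 0)) = (x \<otimes> g 0) \<otimes> ?t"
    unfolding ordered_prod_def using assms(1) tail by (simp add: upt_conv_Cons)
  also have "\<dots> = x \<otimes> (g 0 \<otimes> ?t)" using t assms by (simp add: m_assoc)
  also have "g 0 \<otimes> ?t = ordered_prod G n g"
    unfolding ordered_prod_def using assms(1) by (simp add: upt_conv_Cons)
  finally show ?thesis .
qed

lemma carrier_power_group: "carrier (power_group G n) = ({..<n} \<rightarrow>\<^sub>E carrier G)"
  and mult_power_group: "mult (power_group G n) = (\<lambda>f g. \<lambda>i\<in>{..<n}. f i \<otimes>\<^bsub>G\<^esub> g i)"
  by (simp_all add: power_group_def)

lemma (in group) group_power_group: "group (power_group G n)"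
  by (simp add: power_group_def is_group)

lemma (in group) inv_power_group:
  "f \<in> {..<n} \<rightarrow>\<^sub>E carrier G \<Longrightarrow> inv\<^bsub>power_group G n\<^esub> f = (\<lambda>i\<in>{..<n}. inv f i)"
  by (simp add: power_group_def is_group)

text \<open>The ordered product is multiplicative only modulo commutators: map it to the abelianization first, where the
factors can be rearranged.\<close>

lemma (in group) K_kernel_group_hom:
  "group_hom (power_group G n) (abelianization G)
    (\<lambda>g. derived G (carrier G) #> ordered_prod G n g)"
proof -
  let ?D = "derived G (carrier G)"
  interpret D: normal ?D G by (rule derived_self_is_normal)
  interpret A: comm_group "G Mod ?D" by (rule derived_quot_is_comm_group)
  interpret q: group_hom G "G Mod ?D" "\<lambda>x. ?D #> x"
    using D.r_coset_hom_Mod by (simp add: group_hom_def group_hom_axioms_def is_group A.is_group)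
  have "(\<lambda>g. ?D #> ordered_prod G n g) \<in> hom (power_group G n) (G Mod ?D)"
  proof (rule homI)
    fix f assume "f \<in> carrier (power_group G n)"
    then show "?D #> ordered_prod G n f \<in> carrier (G Mod ?D)"
      by (intro q.hom_closed ordered_prod_closed) (auto simp: carrier_power_group)
  next
    fix f g assume fg: "f \<in> carrier (power_group G n)" "g \<in> carrier (power_group G n)"
    then have c: "f i \<in> carrier G" "g i \<in> carrier G" if "i < n" for i
      using that by (auto simp: carrier_power_group)
    have "?D #> ordered_prod G n (f \<otimes>\<^bsub>power_group G n\<^esub> g) =
      ?D #> ordered_prod G n (\<lambda>i. f i \<otimes> g i)"
      by (intro arg_cong[of _ _ "r_coset G ?D"] ordered_prod_cong) (simp add: mult_power_group)
    also have "\<dots> = ordered_prod (G Mod ?D) n (\<lambda>i. ?D #> (f i \<otimes> g i))"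
      using c by (intro q.hom_ordered_prod) simp
    also have "\<dots> = ordered_prod (G Mod ?D) n (\<lambda>i. (?D #> f i) \<otimes>\<^bsub>G Mod ?D\<^esub> (?D #> g i))"
      using c by (intro ordered_prod_cong q.hom_mult) simp_all
    also have "\<dots> = ordered_prod (G Mod ?D) n (\<lambda>i. ?D #> f i) \<otimes>\<^bsub>G Mod ?D\<^esub> ordered_prod (G Mod ?D) n (\<lambda>i. ?D #> g i)"
      using c by (intro A.ordered_prod_mult_central A.m_comm q.hom_closed) auto
    also have "\<dots> = (?D #> ordered_prod G n f) \<otimes>\<^bsub>G Mod ?D\<^esub> (?D #> ordered_prod G n g)"
      using q.hom_ordered_prod[of n f] q.hom_ordered_prod[of n g] c by simp
    finally show "?D #> ordered_prod G n (f \<otimes>\<^bsub>power_group G n\<^esub> g) =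
      (?D #> ordered_prod G n f) \<otimes>\<^bsub>G Mod ?D\<^esub> (?D #> ordered_prod G n g)" .
  qed
  then show ?thesis
    by (simp add: abelianization_def group_hom_def group_hom_axioms_def group_power_group A.is_group)
qed

lemma (in group) K_normal: "K G n \<lhd> power_group G n"
  unfolding K_def using group_hom.normal_kernel[OF K_kernel_group_hom] .

lemma (in group) K_iff:
  "g \<in> K G n \<longleftrightarrow> g \<in> {..<n} \<rightarrow>\<^sub>E carrier G \<and> ordered_prod G n g \<in> derived G (carrier G)"
proof -
  let ?D = "derived G (carrier G)"
  have sub: "subgroup ?D G" by (rule derived_is_subgroup) simp
  have "?D #> ordered_prod G n g = ?D \<longleftrightarrow> ordered_prod G n g \<in> ?D" if "g \<in> {..<n} \<rightarrow>\<^sub>E carrier G"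
  proof -
    have "ordered_prod G n g \<in> carrier G" using that by (intro ordered_prod_closed) auto
    then show ?thesis
      using coset_join1[OF _ _ sub] coset_join2[OF _ sub] subgroup.subset[OF sub] by blast
  qed
  then show ?thesis
    by (auto simp: K_def kernel_def carrier_power_group abelianization_def)
qed

text \<open>A central subgroup is abelian, so that its derived subgroup is trivial.\<close>

lemma (in group) K_central_iff:
  assumes "subgroup M G" "\<And>x y. x \<in> M \<Longrightarrow> y \<in> carrier G \<Longrightarrow> x \<otimes> y = y \<otimes> x"
  shows "m \<in> K (subgroup_of G M) n \<longleftrightarrow> m \<in> {..<n} \<rightarrow>\<^sub>E M \<and> ordered_prod G n m = \<one>"
proof -
  interpret M: group "subgroup_of G M"
    using assms(1) is_group by (rule subgroup.subgroup_is_group)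
  have "x \<in> carrier G" if "x \<in> M" for x using subgroup.mem_carrier[OF assms(1) that] .
  then have "comm_group (subgroup_of G M)"
    using assms(2) by (intro M.group_comm_groupI) simp
  then have "derived (subgroup_of G M) M = {\<one>}"
    using comm_group.derived_eq_singleton[of "subgroup_of G M" M] by simp
  then show ?thesis using M.K_iff[of m n] by simp
qed

lemma (in group) K_subgroup_iff:
  assumes "subgroup N G"
  shows "m \<in> K (subgroup_of G N) n \<longleftrightarrow> m \<in> {..<n} \<rightarrow>\<^sub>E N \<and> ordered_prod G n m \<in> derived G N"
proof -
  interpret N: group "subgroup_of G N"
    using assms(1) is_group by (rule subgroup.subgroup_is_group)
  show ?thesis using N.K_iff[of m n] derived_consistent[OF _ assms, of N] by simp
qed

section \<open>The normal closure of K(N,n)\<close>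

text \<open>Conjugating \<open>(x, x\<^sup>-\<^sup>1, 1, \<dots>)\<close>, which lies in \<open>K(N,n)\<close>, by \<open>(g, 1, \<dots>, 1)\<close> changes it by the factor
\<open>([g,x], 1, \<dots>, 1)\<close>. So a normal subgroup \<open>H\<close> that contains \<open>K(N,n)\<close> also contains all \<open>(c, 1, \<dots>, 1)\<close> with
\<open>c\<close> in \<open>[F,N]\<close>. Taking such a factor out of \<open>f\<close>, with \<open>c\<close> the product of \<open>f\<close>, leaves a tuple with product \<open>1\<close>.\<close>

lemma tuple_in_normal_subgroup_above_K:
  assumes N: "N \<lhd> F" and "n \<ge> 2" and H: "H \<lhd> power_group F n"
    and KN: "K (subgroup_of F N) n \<subseteq> H"
    and f: "f \<in> {..<n} \<rightarrow>\<^sub>E N" "ordered_prod F n f \<in> mixed_commutator F N"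
  shows "f \<in> H"
proof -
  interpret N: normal N F by fact
  let ?P = "power_group F n"
  interpret P: group ?P by (rule N.group_power_group)
  interpret H: normal H ?P by fact
  have NF: "x \<in> carrier F" if "x \<in> N" for x using that by (rule N.mem_carrier)
  note carrier = carrier_power_group mult_power_group
  define \<delta> where "\<delta> x = (\<lambda>i\<in>{..<n}. if i = 0 then x else \<one>\<^bsub>F\<^esub>)" for x
  define \<epsilon> where "\<epsilon> x = (\<lambda>i\<in>{..<n}. if i = 0 then x else if i = 1 then inv\<^bsub>F\<^esub> x else \<one>\<^bsub>F\<^esub>)" for x
  have \<delta>_carrier: "\<delta> x \<in> carrier ?P" if "x \<in> carrier F" for x
    using that by (auto simp: \<delta>_def carrier)
  have \<delta>_mult: "\<delta> (x \<otimes>\<^bsub>F\<^esub> y) = \<delta> x \<otimes>\<^bsub>?P\<^esub> \<delta> y" if "x \<in> carrier F" "y \<in> carrier F" for x y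
    using that by (intro ext) (simp add: \<delta>_def carrier)
  have \<delta>_inv: "\<delta> (inv\<^bsub>F\<^esub> x) = inv\<^bsub>?P\<^esub> \<delta> x" if "x \<in> carrier F" for x
    using that \<delta>_carrier[OF that]
    by (intro ext) (simp add: \<delta>_def carrier N.inv_power_group)
  have \<epsilon>_prod: "ordered_prod F n (\<epsilon> x) = \<one>\<^bsub>F\<^esub>" if "x \<in> carrier F" for x
  proof -
    have "[0..<n] = 0 # 1 # [2..<n]"
      using \<open>n \<ge> 2\<close> by (simp add: upt_conv_Cons numeral_2_eq_2)
    moreover have "foldr (\<lambda>i y. \<epsilon> x i \<otimes>\<^bsub>F\<^esub> y) xs \<one>\<^bsub>F\<^esub> = \<one>\<^bsub>F\<^esub>" if "set xs \<subseteq> {2..<n}" for xs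
      using that by (induction xs) (auto simp: \<epsilon>_def)
    then have "foldr (\<lambda>i y. \<epsilon> x i \<otimes>\<^bsub>F\<^esub> y) [2..<n] \<one>\<^bsub>F\<^esub> = \<one>\<^bsub>F\<^esub>" by simp
    ultimately show ?thesis
      using that \<open>n \<ge> 2\<close> by (simp add: ordered_prod_def) (simp add: \<epsilon>_def)
  qed
  have one_derived: "\<one>\<^bsub>F\<^esub> \<in> derived F N"
    by (rule subgroup.one_closed[OF N.derived_is_subgroup[OF N.subset]])
  have \<epsilon>_H: "\<epsilon> x \<in> H" if "x \<in> N" for x
  proof -
    have "\<epsilon> x \<in> {..<n} \<rightarrow>\<^sub>E N" using that by (auto simp: \<epsilon>_def)
    then show ?thesis
      using KN N.K_subgroup_iff[OF N.is_subgroup] \<epsilon>_prod[OF NF[OF that]] one_derived by auto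
  qed
  define T where "T = {x \<in> carrier F. \<delta> x \<in> H}"
  have "subgroup T F"
  proof (rule N.subgroupI)
    have "\<delta> \<one>\<^bsub>F\<^esub> = \<one>\<^bsub>?P\<^esub>" by (rule ext) (simp add: \<delta>_def power_group_def)
    then show "T \<noteq> {}" unfolding T_def using H.one_closed by auto
  qed (auto simp: T_def \<delta>_mult \<delta>_inv)
  have "mixed_commutator F N \<subseteq> T"
    unfolding mixed_commutator_def
  proof (rule N.generate_subgroup_incl[OF _ \<open>subgroup T F\<close>], clarify)
    fix g x assume gx: "g \<in> carrier F" "x \<in> N"
    have "\<delta> (g \<otimes>\<^bsub>F\<^esub> x \<otimes>\<^bsub>F\<^esub> inv\<^bsub>F\<^esub> g \<otimes>\<^bsub>F\<^esub> inv\<^bsub>F\<^esub> x) =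
      (\<delta> g \<otimes>\<^bsub>?P\<^esub> \<epsilon> x \<otimes>\<^bsub>?P\<^esub> inv\<^bsub>?P\<^esub> \<delta> g) \<otimes>\<^bsub>?P\<^esub> \<epsilon> (inv\<^bsub>F\<^esub> x)"
      using gx NF[OF gx(2)] \<delta>_carrier[OF gx(1)]
      by (intro ext) (simp add: \<delta>_inv[symmetric], simp add: \<delta>_def \<epsilon>_def carrier)
    moreover have "\<delta> g \<otimes>\<^bsub>?P\<^esub> \<epsilon> x \<otimes>\<^bsub>?P\<^esub> inv\<^bsub>?P\<^esub> \<delta> g \<in> H"
      using H.inv_op_closed2[OF \<delta>_carrier[OF gx(1)] \<epsilon>_H[OF gx(2)]] .
    moreover have "\<epsilon> (inv\<^bsub>F\<^esub> x) \<in> H" using gx(2) by (intro \<epsilon>_H) simp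
    ultimately show "g \<otimes>\<^bsub>F\<^esub> x \<otimes>\<^bsub>F\<^esub> inv\<^bsub>F\<^esub> g \<otimes>\<^bsub>F\<^esub> inv\<^bsub>F\<^esub> x \<in> T"
      unfolding T_def using gx NF by simp
  qed
  define c where "c = ordered_prod F n f"
  have fN: "f i \<in> N" if "i < n" for i using f(1) that by auto
  have c: "c \<in> carrier F" "\<delta> c \<in> H"
    using f(2) \<open>mixed_commutator F N \<subseteq> T\<close> by (auto simp: T_def c_def)
  have "c \<in> N"
  proof -
    interpret FN: group "subgroup_of F N" by (rule N.subgroup_is_group) (rule N.is_group)
    show ?thesis using FN.ordered_prod_closed[of n f] fN by (simp add: c_def)
  qed
  define f' where "f' = f(0 := inv\<^bsub>F\<^esub> c \<otimes>\<^bsub>F\<^esub> f 0)"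
  have "ordered_prod F n f' = \<one>\<^bsub>F\<^esub>"
    unfolding f'_def using N.ordered_prod_update_first[of n "inv\<^bsub>F\<^esub> c" f] c(1) \<open>n \<ge> 2\<close> fN NF
    by (simp add: c_def)
  moreover have "f' \<in> {..<n} \<rightarrow>\<^sub>E N"
    using f(1) \<open>c \<in> N\<close> \<open>n \<ge> 2\<close> fN[of 0] by (auto simp: f'_def PiE_iff extensional_def)
  ultimately have "f' \<in> H"
    using KN N.K_subgroup_iff[OF N.is_subgroup] one_derived by auto
  moreover have "f = \<delta> c \<otimes>\<^bsub>?P\<^esub> f'"
  proof (rule ext)
    fix i show "f i = (\<delta> c \<otimes>\<^bsub>?P\<^esub> f') i"
      using f(1) c(1) fN[of i] NF[OF fN, of i]
      by (auto simp: \<delta>_def f'_def carrier PiE_iff extensional_def N.m_assoc[symmetric])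
  qed
  ultimately show ?thesis using c(2) by simp
qed

section \<open>Comparison with a group over G\<close>

text \<open>Commutators do not change when their entries are multiplied by central elements.\<close>

lemma derived_image_mod_center:
  assumes "group_hom F E \<Phi>"
    and cover: "\<And>e. e \<in> carrier E \<Longrightarrow> \<exists>z\<in>center E. \<exists>f\<in>carrier F. e = z \<otimes>\<^bsub>E\<^esub> \<Phi> f"
  shows "derived E (carrier E) = \<Phi> ` derived F (carrier F)"
proof -
  interpret group_hom F E \<Phi> by fact
  have Z: "z \<in> carrier E" "z \<otimes>\<^bsub>E\<^esub> x = x \<otimes>\<^bsub>E\<^esub> z" if "z \<in> center E" "x \<in> carrier E" for z x
    using that by (auto simp: center_def)
  have conj: "(z \<otimes>\<^bsub>E\<^esub> a) \<otimes>\<^bsub>E\<^esub> y \<otimes>\<^bsub>E\<^esub> inv\<^bsub>E\<^esub> (z \<otimes>\<^bsub>E\<^esub> a) = a \<otimes>\<^bsub>E\<^esub> y \<otimes>\<^bsub>E\<^esub> inv\<^bsub>E\<^esub> a"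
    if "z \<in> center E" "a \<in> carrier E" "y \<in> carrier E" for z a y
  proof -
    let ?w = "a \<otimes>\<^bsub>E\<^esub> y \<otimes>\<^bsub>E\<^esub> inv\<^bsub>E\<^esub> a"
    have w: "?w \<in> carrier E" using that by simp
    note z = Z[OF that(1) w]
    have "(z \<otimes>\<^bsub>E\<^esub> a) \<otimes>\<^bsub>E\<^esub> y \<otimes>\<^bsub>E\<^esub> inv\<^bsub>E\<^esub> (z \<otimes>\<^bsub>E\<^esub> a) = (z \<otimes>\<^bsub>E\<^esub> ?w) \<otimes>\<^bsub>E\<^esub> inv\<^bsub>E\<^esub> z"
      using that z(1) by (simp add: H.m_assoc H.inv_mult_group)
    also have "\<dots> = ?w" using w z(1) unfolding z(2) by (simp add: H.m_assoc)
    finally show ?thesis .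
  qed
  have "derived_set E (carrier E) \<subseteq> derived_set E (\<Phi> ` carrier F)"
  proof clarify
    fix g h assume gh: "g \<in> carrier E" "h \<in> carrier E"
    obtain z a where a: "z \<in> center E" "a \<in> carrier F" "g = z \<otimes>\<^bsub>E\<^esub> \<Phi> a" using cover[OF gh(1)] by blast
    obtain w b where b: "w \<in> center E" "b \<in> carrier F" "h = w \<otimes>\<^bsub>E\<^esub> \<Phi> b" using cover[OF gh(2)] by blast
    have w: "w \<in> carrier E" using b(1) by (simp add: center_def)
    have "g \<otimes>\<^bsub>E\<^esub> h \<otimes>\<^bsub>E\<^esub> inv\<^bsub>E\<^esub> g \<otimes>\<^bsub>E\<^esub> inv\<^bsub>E\<^esub> h = \<Phi> a \<otimes>\<^bsub>E\<^esub> h \<otimes>\<^bsub>E\<^esub> inv\<^bsub>E\<^esub> \<Phi> a \<otimes>\<^bsub>E\<^esub> inv\<^bsub>E\<^esub> h"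
      using conj[OF a(1), of "\<Phi> a" h] a(2) gh(2) by (simp only: a(3) hom_closed)
    also have "\<dots> = \<Phi> a \<otimes>\<^bsub>E\<^esub> (h \<otimes>\<^bsub>E\<^esub> inv\<^bsub>E\<^esub> \<Phi> a \<otimes>\<^bsub>E\<^esub> inv\<^bsub>E\<^esub> h)"
      using a(2) gh(2) by (simp add: H.m_assoc)
    also have "h \<otimes>\<^bsub>E\<^esub> inv\<^bsub>E\<^esub> \<Phi> a \<otimes>\<^bsub>E\<^esub> inv\<^bsub>E\<^esub> h = \<Phi> b \<otimes>\<^bsub>E\<^esub> inv\<^bsub>E\<^esub> \<Phi> a \<otimes>\<^bsub>E\<^esub> inv\<^bsub>E\<^esub> \<Phi> b"
      unfolding b(3) using a(2) b(2) by (intro conj b(1)) simp_all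
    also have "\<Phi> a \<otimes>\<^bsub>E\<^esub> \<dots> = \<Phi> a \<otimes>\<^bsub>E\<^esub> \<Phi> b \<otimes>\<^bsub>E\<^esub> inv\<^bsub>E\<^esub> \<Phi> a \<otimes>\<^bsub>E\<^esub> inv\<^bsub>E\<^esub> \<Phi> b"
      using a(2) b(2) by (simp add: H.m_assoc)
    finally show "g \<otimes>\<^bsub>E\<^esub> h \<otimes>\<^bsub>E\<^esub> inv\<^bsub>E\<^esub> g \<otimes>\<^bsub>E\<^esub> inv\<^bsub>E\<^esub> h \<in> derived_set E (\<Phi> ` carrier F)"
      using a(2) b(2) by blast
  qed
  then have "derived E (carrier E) \<subseteq> derived E (\<Phi> ` carrier F)"
    unfolding derived_def by (rule H.mono_generate)
  moreover have "derived E (\<Phi> ` carrier F) \<subseteq> derived E (carrier E)"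
    by (intro H.mono_derived) auto
  ultimately show ?thesis using derived_img[of "carrier F"] by simp
qed

text \<open>Applying \<open>\<Phi>\<close> to the entries of a tuple gives a map \<open>\<theta>\<close> from \<open>K(F,n)\<close> to \<open>K(E,n)/K(M,n)\<close>. It is onto because
\<open>E\<close> is the product of \<open>M\<close> and the image of \<open>\<Phi>\<close>, and because \<open>[E,E]\<close> is the image of \<open>[F,F]\<close>, which allows the
product of a lifted tuple to be adjusted. Its kernel consists of the tuples in \<open>N\<^sup>n\<close> whose product lies in
\<open>[F,F]\<close> and in the kernel of \<open>\<Phi>\<close>, hence in \<open>[F,N]\<close>. These tuples form a normal subgroup that contains \<open>K(N,n)\<close>, and by the
preceding section it is the smallest one.\<close>

proposition K_tilde_iso_K_quotient:
  assumes "group G" "finite (carrier G)" "is_cover G E p"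
    and "group F" "\<Phi> \<in> hom F E" "p \<circ> \<Phi> \<in> epi F G" "n \<ge> 2"
  shows "K_tilde F (kernel F G (p \<circ> \<Phi>)) n \<cong> K_quotient E (kernel E G p) n"
    and "K_quotient E (kernel E G p) n \<cong> K_tilde F (kernel F G (p \<circ> \<Phi>)) n"
proof -
  define M where "M = kernel E G p"
  define N where "N = kernel F G (p \<circ> \<Phi>)"
  have E: "group E" "p \<in> hom E G" "M \<subseteq> center E" "M \<subseteq> derived E (carrier E)"
    using assms(3) by (auto simp: is_cover_def epi_def M_def)
  have pi: "p \<circ> \<Phi> \<in> hom F G" and pi_surj: "(p \<circ> \<Phi>) ` carrier F = carrier G"
    using assms(6) by (auto simp: epi_def)
  interpret \<Phi>: group_hom F E \<Phi>
    using assms(4,5) E(1) by (simp add: group_hom_def group_hom_axioms_def)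
  interpret p: group_hom E G p
    using assms(1) E by (simp add: group_hom_def group_hom_axioms_def)
  interpret pi: group_hom F G "p \<circ> \<Phi>"
    using assms(1,4) pi by (simp add: group_hom_def group_hom_axioms_def)
  have subM: "subgroup M E" unfolding M_def by (rule p.subgroup_kernel)
  have M: "x \<in> M \<longleftrightarrow> x \<in> carrier E \<and> p x = \<one>\<^bsub>G\<^esub>" for x by (simp add: M_def kernel_def)
  have N: "x \<in> N \<longleftrightarrow> x \<in> carrier F \<and> p (\<Phi> x) = \<one>\<^bsub>G\<^esub>" for x by (simp add: N_def kernel_def)
  have normN: "N \<lhd> F" unfolding N_def by (rule pi.normal_kernel)
  have central: "x \<otimes>\<^bsub>E\<^esub> y = y \<otimes>\<^bsub>E\<^esub> x" if "x \<in> M" "y \<in> carrier E" for x y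
    using E(3) that by (auto simp: center_def)
  have derived_image: "derived E (carrier E) = \<Phi> ` derived F (carrier F)"
  proof (rule derived_image_mod_center[OF \<Phi>.group_hom_axioms])
    fix e assume e: "e \<in> carrier E"
    then have "p e \<in> (p \<circ> \<Phi>) ` carrier F" unfolding pi_surj by simp
    then obtain f where f: "f \<in> carrier F" "p e = p (\<Phi> f)" by auto
    have "e \<otimes>\<^bsub>E\<^esub> inv\<^bsub>E\<^esub> \<Phi> f \<in> center E"
      using E(3) e f by (intro subsetD[OF E(3)]) (simp add: M)
    moreover have "e = (e \<otimes>\<^bsub>E\<^esub> inv\<^bsub>E\<^esub> \<Phi> f) \<otimes>\<^bsub>E\<^esub> \<Phi> f"
      using e f(1) by (simp add: \<Phi>.H.m_assoc)
    ultimately show "\<exists>z\<in>center E. \<exists>f\<in>carrier F. e = z \<otimes>\<^bsub>E\<^esub> \<Phi> f" using f(1) by blast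
  qed
  let ?PF = "power_group F n" and ?PE = "power_group E n"
  define KF where "KF = K F n"
  define KE where "KE = K E n"
  define KM where "KM = K (subgroup_of E M) n"
  note KM_iff = \<Phi>.H.K_central_iff[OF subM central, of _ n, folded KM_def]
  note KE_iff = \<Phi>.H.K_iff[of _ n, folded KE_def]
  note KF_iff = \<Phi>.G.K_iff[of _ n, folded KF_def]
  interpret PF: group ?PF by (rule \<Phi>.G.group_power_group)
  interpret PE: group ?PE by (rule \<Phi>.H.group_power_group)
  interpret KF: normal KF ?PF unfolding KF_def by (rule \<Phi>.G.K_normal)
  interpret KE: normal KE ?PE unfolding KE_def by (rule \<Phi>.H.K_normal)
  interpret SF: group "subgroup_of ?PF KF" by (rule KF.subgroup_is_group) (rule PF.is_group)
  interpret SE: group "subgroup_of ?PE KE" by (rule KE.subgroup_is_group) (rule PE.is_group)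
  have ME: "x \<in> carrier E" if "x \<in> M" for x using that by (simp add: M)
  have KM_KE: "KM \<subseteq> KE"
  proof
    fix m assume "m \<in> KM"
    then show "m \<in> KE"
      using ME subgroup.one_closed[OF \<Phi>.H.derived_is_subgroup[of "carrier E"]]
      by (auto simp: KM_iff KE_iff PiE_iff)
  qed
  have grpM: "group (subgroup_of E M)" by (rule subgroup.subgroup_is_group[OF subM E(1)])
  have subKM': "subgroup KM (power_group (subgroup_of E M) n)"
    unfolding KM_def by (rule normal_imp_subgroup) (rule group.K_normal[OF grpM])
  have KM_E: "m \<in> {..<n} \<rightarrow>\<^sub>E carrier E" if "m \<in> KM" for m
    using that ME by (auto simp: KM_iff PiE_iff)
  have "subgroup KM ?PE"
  proof (rule PE.subgroupI)
    show "KM \<subseteq> carrier ?PE" using KM_E by (auto simp: carrier_power_group)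
    show "KM \<noteq> {}" using subgroup.one_closed[OF subKM'] by blast
  next
    fix m assume m: "m \<in> KM"
    then have "inv\<^bsub>power_group (subgroup_of E M) n\<^esub> m = inv\<^bsub>?PE\<^esub> m"
      using KM_E[OF m] \<Phi>.H.m_inv_consistent[OF subM]
      by (auto simp: group.inv_power_group[OF grpM] \<Phi>.H.inv_power_group KM_iff intro!: restrict_ext)
    then show "inv\<^bsub>?PE\<^esub> m \<in> KM" using subgroup.m_inv_closed[OF subKM' m] by simp
  next
    fix m m' assume "m \<in> KM" "m' \<in> KM"
    then show "m \<otimes>\<^bsub>?PE\<^esub> m' \<in> KM"
      using subgroup.m_closed[OF subKM'] by (simp add: mult_power_group)
  qed
  then have subKM: "subgroup KM (subgroup_of ?PE KE)"
    using KM_KE KE.is_subgroup by (intro PE.subgroup_incl)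
  have "KM \<lhd> subgroup_of ?PE KE"
  proof (rule SE.normalI[OF subKM], rule ballI)
    fix e assume "e \<in> carrier (subgroup_of ?PE KE)"
    then have e: "e i \<in> carrier E" if "i < n" for i
      using that by (auto simp: KE_iff)
    have "m \<otimes>\<^bsub>?PE\<^esub> e = e \<otimes>\<^bsub>?PE\<^esub> m" if "m \<in> KM" for m
      using that e central by (auto simp: mult_power_group KM_iff PiE_iff intro!: restrict_ext)
    then show "KM #>\<^bsub>subgroup_of ?PE KE\<^esub> e = e <#\<^bsub>subgroup_of ?PE KE\<^esub> KM"
      by (simp add: r_coset_def l_coset_def)
  qed
  then interpret KM: normal KM "subgroup_of ?PE KE" .
  let ?Q = "subgroup_of ?PE KE Mod KM"
  have Q: "K_quotient E M n = ?Q" by (simp add: K_quotient_def KE_def KM_def)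
  interpret Q: group ?Q by (rule KM.factorgroup_is_group)
  define \<Theta> where "\<Theta> f = (\<lambda>i\<in>{..<n}. \<Phi> (f i))" for f
  have \<Theta>_prod: "ordered_prod E n (\<Theta> f) = \<Phi> (ordered_prod F n f)"
    if "\<And>i. i < n \<Longrightarrow> f i \<in> carrier F" for f
  proof -
    have "ordered_prod E n (\<Theta> f) = ordered_prod E n (\<lambda>i. \<Phi> (f i))"
      by (rule ordered_prod_cong) (simp add: \<Theta>_def)
    then show ?thesis using \<Phi>.hom_ordered_prod[of n f] that by simp
  qed
  have KF_E: "f i \<in> carrier F" if "f \<in> KF" "i < n" for f i
    using that by (auto simp: KF_iff)
  have \<Theta>_KE: "\<Theta> f \<in> KE" if "f \<in> KF" for f
  proof -
    have "\<Theta> f \<in> {..<n} \<rightarrow>\<^sub>E carrier E" using KF_E[OF that] by (auto simp: \<Theta>_def)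
    moreover have "ordered_prod E n (\<Theta> f) \<in> derived E (carrier E)"
      using that \<Theta>_prod[of f, OF KF_E[OF that]] by (simp add: KF_iff derived_image)
    ultimately show ?thesis by (simp add: KE_iff)
  qed
  define \<theta> where "\<theta> f = KM #>\<^bsub>subgroup_of ?PE KE\<^esub> \<Theta> f" for f
  have "\<theta> \<in> hom (subgroup_of ?PF KF) ?Q"
  proof (rule homI)
    fix f assume "f \<in> carrier (subgroup_of ?PF KF)"
    then show "\<theta> f \<in> carrier ?Q"
      using \<Theta>_KE by (auto simp: \<theta>_def carrier_FactGroup)
  next
    fix f g assume fg: "f \<in> carrier (subgroup_of ?PF KF)" "g \<in> carrier (subgroup_of ?PF KF)"
    then have "\<Theta> (f \<otimes>\<^bsub>?PF\<^esub> g) = \<Theta> f \<otimes>\<^bsub>?PE\<^esub> \<Theta> g"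
      using KF_E by (intro ext) (simp add: \<Theta>_def mult_power_group)
    then show "\<theta> (f \<otimes>\<^bsub>subgroup_of ?PF KF\<^esub> g) = \<theta> f \<otimes>\<^bsub>?Q\<^esub> \<theta> g"
      using KM.rcos_sum[of "\<Theta> f" "\<Theta> g"] fg \<Theta>_KE by (simp add: \<theta>_def)
  qed
  then interpret \<theta>: group_hom "subgroup_of ?PF KF" ?Q \<theta>
    by (simp add: group_hom_def group_hom_axioms_def SF.is_group Q.is_group)
  have \<theta>_surj: "\<theta> ` carrier (subgroup_of ?PF KF) = carrier ?Q"
  proof
    show "\<theta> ` carrier (subgroup_of ?PF KF) \<subseteq> carrier ?Q" using \<theta>.hom_closed by blast
    show "carrier ?Q \<subseteq> \<theta> ` carrier (subgroup_of ?PF KF)"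
    proof
      fix c assume "c \<in> carrier ?Q"
      then obtain e where e: "e \<in> KE" "c = KM #>\<^bsub>subgroup_of ?PE KE\<^esub> e"
        by (auto simp: carrier_FactGroup)
      have eE: "e i \<in> carrier E" if "i < n" for i using e(1) that by (auto simp: KE_iff)
      have "\<exists>f\<in>carrier F. p (\<Phi> f) = p (e i)" if "i < n" for i
      proof -
        have "p (e i) \<in> (p \<circ> \<Phi>) ` carrier F" using eE[OF that] unfolding pi_surj by simp
        then show ?thesis by force
      qed
      then obtain f0 where f0: "f0 i \<in> carrier F" "p (\<Phi> (f0 i)) = p (e i)" if "i < n" for i
        by metis
      have "ordered_prod E n e \<in> \<Phi> ` derived F (carrier F)"
        using e(1) by (simp add: KE_iff derived_image)
      then obtain d where d: "d \<in> derived F (carrier F)" "\<Phi> d = ordered_prod E n e" by auto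
      have dF: "d \<in> carrier F" using d(1) \<Phi>.G.derived_in_carrier by blast
      define c0 where "c0 = ordered_prod F n f0"
      have c0: "c0 \<in> carrier F" unfolding c0_def using f0(1) by (rule \<Phi>.G.ordered_prod_closed)
      have "(p \<circ> \<Phi>) c0 = ordered_prod G n (\<lambda>i. (p \<circ> \<Phi>) (f0 i))"
        unfolding c0_def using f0(1) by (rule pi.hom_ordered_prod)
      also have "\<dots> = ordered_prod G n (\<lambda>i. p (e i))"
        by (rule ordered_prod_cong) (simp add: f0(2))
      also have "\<dots> = p (\<Phi> d)"
        using p.hom_ordered_prod[of n e] eE by (simp add: d(2))
      finally have p_c0: "p (\<Phi> c0) = p (\<Phi> d)" by simp
      \<comment> \<open>Make the product of the lifted tuple equal to \<open>d\<close>; the first entry keeps its image in \<open>G\<close> by \<open>p_c0\<close>.\<close>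
      define f where "f = restrict (f0(0 := d \<otimes>\<^bsub>F\<^esub> inv\<^bsub>F\<^esub> c0 \<otimes>\<^bsub>F\<^esub> f0 0)) {..<n}"
      have fF: "f i \<in> carrier F" "p (\<Phi> (f i)) = p (e i)" if "i < n" for i
        using that f0[OF that] f0[of 0] eE[OF that] dF c0 by (auto simp: f_def p_c0)
      have "ordered_prod F n f = ordered_prod F n (f0(0 := (d \<otimes>\<^bsub>F\<^esub> inv\<^bsub>F\<^esub> c0) \<otimes>\<^bsub>F\<^esub> f0 0))"
        by (rule ordered_prod_cong) (simp add: f_def)
      also have "\<dots> = (d \<otimes>\<^bsub>F\<^esub> inv\<^bsub>F\<^esub> c0) \<otimes>\<^bsub>F\<^esub> c0"
        unfolding c0_def using assms(7) dF c0 f0(1)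
        by (intro \<Phi>.G.ordered_prod_update_first) (auto simp: c0_def)
      also have "\<dots> = d" using dF c0 by (simp add: \<Phi>.G.m_assoc)
      finally have f_prod: "ordered_prod F n f = d" .
      have fK: "f \<in> KF"
        using fF(1) f_prod d(1) by (auto simp: KF_iff f_def PiE_iff)
      \<comment> \<open>The discrepancy \<open>m\<close> has product \<open>1\<close> since it is central and \<open>\<Theta> f\<close> and \<open>e\<close> have the same product.\<close>
      define m where "m = (\<lambda>i\<in>{..<n}. \<Phi> (f i) \<otimes>\<^bsub>E\<^esub> inv\<^bsub>E\<^esub> e i)"
      have mM: "m i \<in> M" if "i < n" for i
        using that fF[OF that] eE[OF that] by (simp add: m_def M)
      have split: "\<Theta> f = m \<otimes>\<^bsub>?PE\<^esub> e"
        using fF(1) eE by (intro ext) (simp add: \<Theta>_def m_def mult_power_group \<Phi>.H.m_assoc)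
      have "ordered_prod E n m \<otimes>\<^bsub>E\<^esub> ordered_prod E n e = ordered_prod E n (\<lambda>i. m i \<otimes>\<^bsub>E\<^esub> e i)"
        using mM ME eE central by (intro \<Phi>.H.ordered_prod_mult_central[symmetric]) auto
      also have "\<dots> = ordered_prod E n (\<Theta> f)"
        unfolding split by (rule ordered_prod_cong) (simp add: mult_power_group)
      also have "\<dots> = ordered_prod E n e"
        using \<Theta>_prod[of f] fF(1) f_prod d(2) by simp
      finally have "ordered_prod E n m = \<one>\<^bsub>E\<^esub>"
        using \<Phi>.H.ordered_prod_closed[of n m] \<Phi>.H.ordered_prod_closed[of n e] mM ME eE
        by (simp add: \<Phi>.H.l_cancel_one')
      moreover have "m \<in> {..<n} \<rightarrow>\<^sub>E M" using mM by (auto simp: m_def)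
      ultimately have "m \<in> KM" by (simp add: KM_iff)
      then have "\<Theta> f \<in> KM #>\<^bsub>subgroup_of ?PE KE\<^esub> e"
        unfolding r_coset_def split by auto
      then have "c = \<theta> f"
        unfolding e(2) \<theta>_def using SE.repr_independence[OF _ _ subKM] e(1) by simp
      then show "c \<in> \<theta> ` carrier (subgroup_of ?PF KF)" using fK by simp
    qed
  qed
  define W where "W = kernel (subgroup_of ?PF KF) ?Q \<theta>"
  have W_iff: "f \<in> W \<longleftrightarrow> f \<in> KF \<and> f \<in> {..<n} \<rightarrow>\<^sub>E N \<and> \<Phi> (ordered_prod F n f) = \<one>\<^bsub>E\<^esub>" for f
  proof -
    have "f \<in> W \<longleftrightarrow> f \<in> KF \<and> \<Theta> f \<in> KM"
      using SE.coset_join1[OF _ _ subKM, of "\<Theta> f"] SE.coset_join2[OF _ subKM, of "\<Theta> f"] \<Theta>_KE[of f] KM_KE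
      by (auto simp: W_def kernel_def \<theta>_def)
    also have "\<dots> \<longleftrightarrow> f \<in> KF \<and> f \<in> {..<n} \<rightarrow>\<^sub>E N \<and> \<Phi> (ordered_prod F n f) = \<one>\<^bsub>E\<^esub>"
    proof (intro conj_cong refl)
      assume f: "f \<in> KF"
      have "\<Theta> f \<in> {..<n} \<rightarrow>\<^sub>E M \<longleftrightarrow> f \<in> {..<n} \<rightarrow>\<^sub>E N"
        using f KF_E[OF f] by (auto simp: \<Theta>_def M N PiE_iff KF_iff)
      then show "\<Theta> f \<in> KM \<longleftrightarrow> f \<in> {..<n} \<rightarrow>\<^sub>E N \<and> \<Phi> (ordered_prod F n f) = \<one>\<^bsub>E\<^esub>"
        using \<Theta>_prod[of f, OF KF_E[OF f]] by (simp add: KM_iff)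
    qed
    finally show ?thesis .
  qed
  have NF: "x \<in> carrier F" if "x \<in> N" for x using that by (simp add: N)
  \<comment> \<open>Conjugation by \<open>g\<close> does not change \<open>\<Theta> f\<close>, since the entries of \<open>\<Theta> f\<close> are central.\<close>
  have "W \<lhd> ?PF"
    unfolding PF.normal_inv_iff
  proof (intro conjI ballI)
    have "subgroup W (subgroup_of ?PF KF)" unfolding W_def by (rule \<theta>.subgroup_kernel)
    then show "subgroup W ?PF" using PF.incl_subgroup[OF KF.is_subgroup] by blast
  next
    fix g f assume g: "g \<in> carrier ?PF" and f: "f \<in> W"
    have fN: "f i \<in> N" if "i < n" for i
      using f that by (auto simp: W_iff)
    have gF: "g i \<in> carrier F" if "i < n" for i using g that by (auto simp: carrier_power_group)
    have fK: "f \<in> KF" using f by (simp add: W_iff)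
    let ?h = "g \<otimes>\<^bsub>?PF\<^esub> f \<otimes>\<^bsub>?PF\<^esub> inv\<^bsub>?PF\<^esub> g"
    have h: "?h i = g i \<otimes>\<^bsub>F\<^esub> f i \<otimes>\<^bsub>F\<^esub> inv\<^bsub>F\<^esub> g i" if "i < n" for i
      using g that by (simp add: mult_power_group \<Phi>.G.inv_power_group carrier_power_group)
    have hK: "?h \<in> KF" using KF.inv_op_closed2[OF g fK] .
    have hN: "?h i \<in> N" if "i < n" for i
      unfolding h[OF that] using gF[OF that] fN[OF that] by (rule normal.inv_op_closed2[OF normN])
    have "\<Theta> ?h i = \<Theta> f i" if "i < n" for i
    proof -
      have "\<Phi> (f i) \<in> M" using fN[OF that] by (simp add: M N)
      then have commute: "\<Phi> (g i) \<otimes>\<^bsub>E\<^esub> \<Phi> (f i) = \<Phi> (f i) \<otimes>\<^bsub>E\<^esub> \<Phi> (g i)"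
        using central[of "\<Phi> (f i)" "\<Phi> (g i)"] gF[OF that] by simp
      have "\<Phi> (?h i) = \<Phi> (g i) \<otimes>\<^bsub>E\<^esub> \<Phi> (f i) \<otimes>\<^bsub>E\<^esub> inv\<^bsub>E\<^esub> \<Phi> (g i)"
        unfolding h[OF that] using gF[OF that] NF[OF fN[OF that]] by simp
      also have "\<dots> = \<Phi> (f i)"
        unfolding commute using gF[OF that] NF[OF fN[OF that]] by (simp add: \<Phi>.H.m_assoc)
      finally show ?thesis using that by (simp only: \<Theta>_def) simp
    qed
    then have "ordered_prod E n (\<Theta> ?h) = ordered_prod E n (\<Theta> f)" by (rule ordered_prod_cong)
    then have "\<Phi> (ordered_prod F n ?h) = \<one>\<^bsub>E\<^esub>"
      using f \<Theta>_prod[of ?h] \<Theta>_prod[of f] KF_E[OF hK] KF_E[OF fK] by (simp add: W_iff)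
    moreover have "?h \<in> {..<n} \<rightarrow>\<^sub>E N"
      using hN hK by (auto simp: KF_iff PiE_iff)
    ultimately show "?h \<in> W" using hK by (simp add: W_iff)
  qed
  have subN: "subgroup N F" using normN by (rule normal_imp_subgroup)
  have "K (subgroup_of F N) n \<subseteq> W"
  proof
    fix f assume "f \<in> K (subgroup_of F N) n"
    then have f: "f \<in> {..<n} \<rightarrow>\<^sub>E N" "ordered_prod F n f \<in> derived F N"
      by (simp_all add: \<Phi>.G.K_subgroup_iff[OF subN])
    have "derived F N \<subseteq> derived F (carrier F)" using NF by (intro \<Phi>.G.mono_derived) auto
    then have "f \<in> KF" using f NF by (auto simp: KF_iff PiE_iff)
    \<comment> \<open>\<open>\<Phi>\<close> maps \<open>N\<close> into an abelian group, so it kills \<open>[N,N]\<close>.\<close>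
    have "\<Phi> ` N \<subseteq> M" by (auto simp: M N)
    then have "derived E (\<Phi> ` N) \<subseteq> derived E M" by (intro \<Phi>.H.mono_derived)
    also have "derived E M = {\<one>\<^bsub>E\<^esub>}"
    proof -
      have "comm_group (subgroup_of E M)"
        using central ME by (intro group.group_comm_groupI[OF grpM]) simp
      then show ?thesis
        using comm_group.derived_eq_singleton[of "subgroup_of E M" M] \<Phi>.H.derived_consistent[OF _ subM, of M]
        by simp
    qed
    finally have "\<Phi> ` derived F N \<subseteq> {\<one>\<^bsub>E\<^esub>}"
      using \<Phi>.derived_img[of N] NF by auto
    then show "f \<in> W" using f \<open>f \<in> KF\<close> by (auto simp: W_iff)
  qed
  have W: "W = normal_closure ?PF (K (subgroup_of F N) n)"
  proof
    show "normal_closure ?PF (K (subgroup_of F N) n) \<subseteq> W"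
      unfolding normal_closure_def using \<open>W \<lhd> ?PF\<close> \<open>K (subgroup_of F N) n \<subseteq> W\<close> by blast
    show "W \<subseteq> normal_closure ?PF (K (subgroup_of F N) n)"
      unfolding normal_closure_def
    proof clarify
      fix f H assume f: "f \<in> W" and H: "H \<lhd> ?PF" "K (subgroup_of F N) n \<subseteq> H"
      then have "f \<in> {..<n} \<rightarrow>\<^sub>E N" "ordered_prod F n f \<in> derived F (carrier F)"
        "\<Phi> (ordered_prod F n f) = \<one>\<^bsub>E\<^esub>"
        by (simp_all add: W_iff KF_iff)
      then show "f \<in> H"
        using kernel_in_derived_subset_mixed_commutator[OF assms(1-6), folded N_def]
        by (intro tuple_in_normal_subgroup_above_K[OF normN assms(7) H]) simp_all
    qed
  qed
  have iso: "(subgroup_of ?PF KF Mod W) \<cong> ?Q"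
    unfolding W_def by (rule \<theta>.FactGroup_iso[OF \<theta>_surj])
  have "group (subgroup_of ?PF KF Mod W)"
    unfolding W_def by (rule normal.factorgroup_is_group[OF \<theta>.normal_kernel])
  then have "?Q \<cong> (subgroup_of ?PF KF Mod W)" using iso by (rule group.iso_sym)
  moreover have "subgroup_of ?PF KF Mod W = K_tilde F N n"
    unfolding W by (simp add: K_tilde_def KF_def)
  ultimately show "K_tilde F (kernel F G (p \<circ> \<Phi>)) n \<cong> K_quotient E (kernel E G p) n"
    "K_quotient E (kernel E G p) n \<cong> K_tilde F (kernel F G (p \<circ> \<Phi>)) n"
    using iso by (simp_all add: Q flip: M_def N_def)
qed

text \<open>The fibre product of two covers over \<open>G\<close> maps to both, and the two composites to \<open>G\<close> coincide, so the same
group \<open>K_tilde\<close> is isomorphic to both quotients.\<close>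

lemma K_quotient_unique:
  assumes "group G" "finite (carrier G)" "is_cover G E p" "is_cover G E' p'" "n \<ge> 2"
  shows "K_quotient E (kernel E G p) n \<cong> K_quotient E' (kernel E' G p') n"
proof -
  have E: "group E" "p \<in> hom E G" "p ` carrier E = carrier G"
    and E': "group E'" "p' \<in> hom E' G" "p' ` carrier E' = carrier G"
    using assms(3,4) by (auto simp: is_cover_def epi_def)
  interpret p: group_hom E G p using assms(1) E by (simp add: group_hom_def group_hom_axioms_def)
  interpret p': group_hom E' G p' using assms(1) E' by (simp add: group_hom_def group_hom_axioms_def)
  interpret P: group "E \<times>\<times> E'" using E(1) E'(1) by (rule DirProd_group)
  define A where "A = {(x, y) \<in> carrier E \<times> carrier E'. p x = p' y}"
  have A: "z \<in> A \<longleftrightarrow> fst z \<in> carrier E \<and> snd z \<in> carrier E' \<and> p (fst z) = p' (snd z)" for z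
    by (auto simp: A_def)
  define F where "F = subgroup_of (E \<times>\<times> E') A"
  have "subgroup A (E \<times>\<times> E')"
  proof (rule P.subgroupI)
    have "(\<one>\<^bsub>E\<^esub>, \<one>\<^bsub>E'\<^esub>) \<in> A" by (simp add: A)
    then show "A \<noteq> {}" by blast
  qed (auto simp: A DirProd_def inv_DirProd[OF E(1) E'(1), unfolded DirProd_def])
  then have F: "group F" unfolding F_def by (rule subgroup.subgroup_is_group) (rule P.is_group)
  have carrier_F: "carrier F = A" by (simp add: F_def)
  have fst: "fst \<in> hom F E" and snd: "snd \<in> hom F E'"
    by (auto simp: hom_def F_def A DirProd_def)
  have "(p \<circ> fst) ` carrier F = carrier G"
  proof
    show "(p \<circ> fst) ` carrier F \<subseteq> carrier G"
      unfolding carrier_F by (rule image_subsetI) (simp add: A)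
    show "carrier G \<subseteq> (p \<circ> fst) ` carrier F"
    proof
      fix g assume "g \<in> carrier G"
      then have "g \<in> p ` carrier E" "g \<in> p' ` carrier E'"
        unfolding E(3) E'(3) by simp_all
      then obtain x y where "x \<in> carrier E" "y \<in> carrier E'" "p x = g" "p' y = g"
        by (elim imageE) simp
      then have "(x, y) \<in> carrier F" "g = (p \<circ> fst) (x, y)" by (simp_all add: carrier_F A)
      then show "g \<in> (p \<circ> fst) ` carrier F" by (rule rev_image_eqI)
    qed
  qed
  moreover have agree: "(p \<circ> fst) z = (p' \<circ> snd) z" if "z \<in> carrier F" for z
    using that by (simp add: carrier_F A)
  then have "(p \<circ> fst) ` carrier F = (p' \<circ> snd) ` carrier F" by (rule image_cong[OF refl])
  ultimately have epi: "p \<circ> fst \<in> epi F G" "p' \<circ> snd \<in> epi F G"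
    unfolding epi_def using hom_compose[OF fst E(2)] hom_compose[OF snd E'(2)] by auto
  have ker: "kernel F G (p \<circ> fst) = kernel F G (p' \<circ> snd)"
    using agree unfolding kernel_def by auto
  have "K_quotient E (kernel E G p) n \<cong> K_tilde F (kernel F G (p \<circ> fst)) n"
    by (rule K_tilde_iso_K_quotient(2)[OF assms(1-3) F fst epi(1) assms(5)])
  also have "\<dots> \<cong> K_quotient E' (kernel E' G p') n"
    unfolding ker by (rule K_tilde_iso_K_quotient(1)[OF assms(1,2,4) F snd epi(2) assms(5)])
  finally show ?thesis .
qed

section \<open>Lifting along presentations\<close>

primrec eval_word :: "('b, 'q) monoid_scheme \<Rightarrow> ('x \<Rightarrow> 'b) \<Rightarrow> ('x \<times> bool) list \<Rightarrow> 'b" where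
  "eval_word E \<phi> [] = \<one>\<^bsub>E\<^esub>"
| "eval_word E \<phi> (a # w) =
    (if snd a then \<phi> (fst a) else inv\<^bsub>E\<^esub> \<phi> (fst a)) \<otimes>\<^bsub>E\<^esub> eval_word E \<phi> w"

context group
begin

lemma eval_word_closed:
  assumes "\<phi> ` S \<subseteq> carrier G" "set w \<subseteq> S \<times> UNIV"
  shows "eval_word G \<phi> w \<in> carrier G"
  using assms(2) by (induction w) (use assms(1) in auto)

lemma eval_word_push_letter:
  assumes "\<phi> ` S \<subseteq> carrier G" "fst a \<in> S" "set w \<subseteq> S \<times> UNIV"
  shows "eval_word G \<phi> (push_letter a w) = eval_word G \<phi> (a # w)"
proof (cases w)
  case (Cons b v)
  have v: "eval_word G \<phi> v \<in> carrier G" and a: "\<phi> (fst a) \<in> carrier G"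
    using assms Cons eval_word_closed[OF assms(1), of v] by auto
  show ?thesis
    using a v unfolding Cons by (auto simp: inverse_letters_def m_assoc[symmetric])
qed simp

end

lemma set_push_letter: "set (push_letter a w) \<subseteq> insert a (set w)"
  by (cases w) auto

lemma set_foldr_push_letter: "set (foldr push_letter u w) \<subseteq> set u \<union> set w"
  by (induction u) (use set_push_letter in fastforce)+

lemma (in group) eval_word_append:
  assumes "\<phi> ` S \<subseteq> carrier G" "set u \<subseteq> S \<times> UNIV" "set w \<subseteq> S \<times> UNIV"
  shows "eval_word G \<phi> (foldr push_letter u w) = eval_word G \<phi> u \<otimes> eval_word G \<phi> w"
  using assms(2)
proof (induction u)
  case Nil
  then show ?case using eval_word_closed[OF assms(1,3)] by simp
next
  case (Cons a u)
  have "set (foldr push_letter u w) \<subseteq> S \<times> UNIV"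
    using set_foldr_push_letter[of u w] Cons.prems assms(3) by auto
  moreover have "fst a \<in> S" using Cons.prems by auto
  moreover have "eval_word G \<phi> u \<in> carrier G" "eval_word G \<phi> w \<in> carrier G" "\<phi> (fst a) \<in> carrier G"
    using Cons.prems eval_word_closed[OF assms(1)] assms(3) assms(1) \<open>fst a \<in> S\<close> by auto
  ultimately show ?case
    using Cons eval_word_push_letter[OF assms(1), of a] by (simp add: m_assoc)
qed

lemma reduced_Cons: "reduced (a # w) \<longleftrightarrow> reduced w \<and> (w = [] \<or> \<not> inverse_letters a (hd w))"
  by (cases w) (auto simp: reduced_def)

lemma reduced_push_letter: "reduced w \<Longrightarrow> reduced (push_letter a w)"
  by (cases w) (auto simp: reduced_Cons)

lemma reduced_foldr_push_letter: "reduced w \<Longrightarrow> reduced (foldr push_letter u w)"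
  by (induction u) (auto simp: reduced_push_letter)

lemma push_letter_reduced: "reduced (a # w) \<Longrightarrow> push_letter a w = a # w"
  by (cases w) (auto simp: reduced_Cons)

lemma mult_free_group_closed:
  assumes "u \<in> carrier (free_group_on S)" "w \<in> carrier (free_group_on S)"
  shows "u \<otimes>\<^bsub>free_group_on S\<^esub> w \<in> carrier (free_group_on S)"
  using assms set_foldr_push_letter[of u w]
  by (auto simp: free_group_on_def reduced_foldr_push_letter)

text \<open>A reduced word is the product of its letters, and \<open>(x, False)\<close> is inverse to \<open>(x, True)\<close>, so the values on the
letters \<open>(x, True)\<close> determine the homomorphism.\<close>

lemma (in group) hom_free_group_determined:
  assumes f: "f \<in> hom (free_group_on S) G" and w: "w \<in> carrier (free_group_on S)"
  shows "f w = eval_word G (\<lambda>x. f [(x, True)]) w"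
proof -
  let ?W = "free_group_on S"
  have mult: "f (foldr push_letter u v) = f u \<otimes> f v" if "u \<in> carrier ?W" "v \<in> carrier ?W" for u v
    using hom_mult[OF f that] by (simp add: free_group_on_def)
  have closed: "f u \<in> carrier G" if "u \<in> carrier ?W" for u using hom_carrier[OF f] that by auto
  have nil: "[] \<in> carrier ?W" by (simp add: free_group_on_def reduced_def)
  have f_nil: "f [] = \<one>"
    using mult[OF nil nil] closed[OF nil] by (simp add: l_cancel_one')
  have letter: "[(x, b)] \<in> carrier ?W" if "x \<in> S" for x b
    using that by (simp add: free_group_on_def reduced_def)
  have f_inv: "f [(x, False)] = inv f [(x, True)]" if "x \<in> S" for x
  proof -
    have "f [(x, False)] \<otimes> f [(x, True)] = \<one>"
      using mult[OF letter[OF that] letter[OF that], of False True] f_nil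
      by (simp add: inverse_letters_def)
    then show ?thesis using closed letter[OF that] by (simp add: inv_equality)
  qed
  show ?thesis using w
  proof (induction w)
    case Nil
    then show ?case by (simp add: f_nil)
  next
    case (Cons a w)
    then have w: "w \<in> carrier ?W" and a: "fst a \<in> S"
      by (auto simp: free_group_on_def reduced_Cons)
    have "f (a # w) = f [a] \<otimes> f w"
      using mult[of "[a]" w] w letter[OF a, of "snd a"] push_letter_reduced[of a w] Cons.prems
      by (simp add: free_group_on_def)
    moreover have "f [a] = (if snd a then f [(fst a, True)] else inv f [(fst a, True)])"
      using f_inv[OF a] by (cases a) auto
    ultimately show ?case using Cons.IH[OF w] by simp
  qed
qed

text \<open>Choose preimages under \<open>p\<close> of the images of the basis elements and evaluate words in them.\<close>

lemma free_group_lift: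
  assumes "is_free_group F" "group E" "group G" "p \<in> epi E G" "f \<in> hom F G"
  obtains \<Phi> where "\<Phi> \<in> hom F E" "\<And>x. x \<in> carrier F \<Longrightarrow> p (\<Phi> x) = f x"
proof -
  interpret F: group F using assms(1) by (simp add: is_free_group_def)
  interpret E: group E by fact
  interpret p: group_hom E G p
    using assms(2-4) by (simp add: group_hom_def group_hom_axioms_def epi_def)
  obtain S where "S \<subseteq> carrier F" and S: "free_group_on S \<cong> F"
    using assms(1) by (auto simp: is_free_group_def)
  from S obtain h where h: "h \<in> iso (free_group_on S) F"
    by (auto simp: is_iso_def)
  let ?W = "free_group_on S"
  have h_hom: "h \<in> hom ?W F" and bij: "bij_betw h (carrier ?W) (carrier F)"
    using h by (auto simp: iso_def)
  define k where "k = inv_into (carrier ?W) h"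
  have k: "k x \<in> carrier ?W" "h (k x) = x" if "x \<in> carrier F" for x
    using that bij unfolding k_def by (auto simp: bij_betw_def inv_into_into f_inv_into_f)
  have fh: "f \<circ> h \<in> hom ?W G" using hom_compose[OF h_hom assms(5)] .
  have "\<exists>e\<in>carrier E. p e = (f \<circ> h) [(x, True)]" if "x \<in> S" for x
  proof -
    have "[(x, True)] \<in> carrier ?W" using that by (simp add: free_group_on_def reduced_def)
    then have "(f \<circ> h) [(x, True)] \<in> p ` carrier E"
      using hom_carrier[OF fh] assms(4) by (auto simp: epi_def)
    then show ?thesis by force
  qed
  then obtain \<phi> where \<phi>: "\<And>x. x \<in> S \<Longrightarrow> \<phi> x \<in> carrier E" "\<And>x. x \<in> S \<Longrightarrow> p (\<phi> x) = (f \<circ> h) [(x, True)]"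
    by metis
  have \<phi>_im: "\<phi> ` S \<subseteq> carrier E" using \<phi>(1) by blast
  have words: "set w \<subseteq> S \<times> UNIV" if "w \<in> carrier ?W" for w using that by (simp add: free_group_on_def)
  define \<Phi> where "\<Phi> x = eval_word E \<phi> (k x)" for x
  have "\<Phi> \<in> hom F E"
  proof (rule homI)
    fix x assume x: "x \<in> carrier F"
    show "\<Phi> x \<in> carrier E"
      unfolding \<Phi>_def by (rule E.eval_word_closed[OF \<phi>_im words[OF k(1)[OF x]]])
  next
    fix x y assume xy: "x \<in> carrier F" "y \<in> carrier F"
    have "h (k x \<otimes>\<^bsub>?W\<^esub> k y) = h (k (x \<otimes>\<^bsub>F\<^esub> y))"
      using xy k by (simp add: hom_mult[OF h_hom])
    then have "k (x \<otimes>\<^bsub>F\<^esub> y) = k x \<otimes>\<^bsub>?W\<^esub> k y"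
      using bij xy k(1) mult_free_group_closed unfolding bij_betw_def by (metis F.m_closed inj_onD)
    then show "\<Phi> (x \<otimes>\<^bsub>F\<^esub> y) = \<Phi> x \<otimes>\<^bsub>E\<^esub> \<Phi> y"
      unfolding \<Phi>_def using E.eval_word_append[OF \<phi>_im words words] k(1) xy
      by (simp add: free_group_on_def)
  qed
  moreover have "p (\<Phi> x) = f x" if x: "x \<in> carrier F" for x
  proof -
    have "p (eval_word E \<phi> w) = eval_word G (\<lambda>x. (f \<circ> h) [(x, True)]) w" if "set w \<subseteq> S \<times> UNIV" for w
      using that
    proof (induction w)
      case (Cons a w)
      then have "fst a \<in> S" "eval_word E \<phi> w \<in> carrier E"
        using E.eval_word_closed[OF \<phi>_im, of w] by auto
      then show ?case using Cons \<phi> by simp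
    qed simp
    then have "p (\<Phi> x) = (f \<circ> h) (k x)"
      unfolding \<Phi>_def using group.hom_free_group_determined[OF assms(3) fh k(1)[OF x]] words[OF k(1)[OF x]] by simp
    then show ?thesis using k(2)[OF x] by simp
  qed
  ultimately show thesis by (rule that)
qed

text \<open>Turns an isomorphism \<open>F/N \<cong> G\<close> into an epimorphism with kernel \<open>N\<close>, the form in which a group over \<open>G\<close> was
treated above.\<close>

lemma presentation_epi:
  assumes "group G" "is_presentation F N G"
  obtains f where "f \<in> epi F G" "kernel F G f = N"
proof -
  interpret N: normal N F using assms(2) by (simp add: is_presentation_def)
  interpret Q: group "F Mod N" by (rule N.factorgroup_is_group)
  obtain h where h: "h \<in> hom (F Mod N) G" "bij_betw h (carrier (F Mod N)) (carrier G)"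
    using assms(2) by (auto simp: is_presentation_def is_iso_def iso_def)
  interpret h: group_hom "F Mod N" G h
    using h(1) assms(1) by (simp add: group_hom_def group_hom_axioms_def Q.is_group)
  let ?f = "h \<circ> (\<lambda>x. N #>\<^bsub>F\<^esub> x)"
  have "?f \<in> hom F G" using hom_compose[OF N.r_coset_hom_Mod h(1)] .
  moreover have "?f ` carrier F = carrier G"
    using h(2) by (simp add: bij_betw_def carrier_FactGroup image_comp comp_def)
  ultimately have "?f \<in> epi F G" by (simp add: epi_def)
  moreover have "kernel F G ?f = N"
  proof -
    have "?f x = \<one>\<^bsub>G\<^esub> \<longleftrightarrow> x \<in> N" if x: "x \<in> carrier F" for x
    proof -
      have "N #>\<^bsub>F\<^esub> x \<in> carrier (F Mod N)" "N \<in> carrier (F Mod N)"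
        using x Q.one_closed by (auto simp: carrier_FactGroup)
      then have "h (N #>\<^bsub>F\<^esub> x) = h N \<longleftrightarrow> N #>\<^bsub>F\<^esub> x = N"
        using h(2) by (auto simp: bij_betw_def inj_on_eq_iff)
      moreover have "h N = \<one>\<^bsub>G\<^esub>" using h.hom_one by simp
      moreover have "N #>\<^bsub>F\<^esub> x = N \<longleftrightarrow> x \<in> N"
        using N.coset_join1[OF _ x N.is_subgroup] N.coset_join2[OF x N.is_subgroup] by blast
      ultimately show ?thesis by simp
    qed
    then show ?thesis using N.subset by (auto simp: kernel_def)
  qed
  ultimately show thesis by (rule that)
qed

section \<open>Independence of the cover and of the presentation\<close>

theorem theorem3p2:
  fixes G :: "('a, 'm) monoid_scheme"
    and E :: "('b, 'q) monoid_scheme"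
    and p :: "'b \<Rightarrow> 'a"
    and n :: nat
  assumes "group G" and "finite (carrier G)"
    and "is_cover G E p"
    and "n \<ge> 2"
  shows "(\<forall>(F :: ('f, 'r) monoid_scheme) N.
            is_presentation F N G \<longrightarrow> K_quotient E (kernel E G p) n \<cong> K_tilde F N n)
       \<and> (\<forall>(E' :: ('c, 's) monoid_scheme) p'.
            is_cover G E' p' \<longrightarrow>
              K_quotient E (kernel E G p) n \<cong> K_quotient E' (kernel E' G p') n)"
proof (intro conjI allI impI)
  fix F :: "('f, 'r) monoid_scheme" and N
  assume pres: "is_presentation F N G"
  then have F: "is_free_group F" "group F"
    by (simp_all add: is_presentation_def is_free_group_def)
  have E: "group E" "p \<in> epi E G" using assms(3) by (simp_all add: is_cover_def)
  obtain f where f: "f \<in> epi F G" "kernel F G f = N"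
    using assms(1) pres by (rule presentation_epi)
  have "f \<in> hom F G" using f(1) by (simp add: epi_def)
  then obtain \<Phi> where \<Phi>: "\<Phi> \<in> hom F E" "\<And>x. x \<in> carrier F \<Longrightarrow> p (\<Phi> x) = f x"
    using free_group_lift[OF F(1) E(1) assms(1) E(2)] by blast
  have "p \<circ> \<Phi> \<in> epi F G"
  proof -
    have "p \<circ> \<Phi> \<in> hom F G" using \<Phi>(1) E(2) by (auto simp: epi_def intro: hom_compose)
    moreover have "(p \<circ> \<Phi>) ` carrier F = f ` carrier F" using \<Phi>(2) by (intro image_cong) simp_all
    ultimately show ?thesis using f(1) by (simp add: epi_def)
  qed
  moreover have "kernel F G (p \<circ> \<Phi>) = N"
    using f(2) \<Phi>(2) by (auto simp: kernel_def)
  ultimately show "K_quotient E (kernel E G p) n \<cong> K_tilde F N n"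
    using K_tilde_iso_K_quotient(2)[OF assms(1-3) F(2) \<Phi>(1) _ assms(4)] by simp
next
  fix E' :: "('c, 's) monoid_scheme" and p'
  assume "is_cover G E' p'"
  then show "K_quotient E (kernel E G p) n \<cong> K_quotient E' (kernel E' G p') n"
    by (rule K_quotient_unique[OF assms(1-3) _ assms(4)])
qed

end
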